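(* Let $t\mapsto\mu_t$ be a piecewise continuous function from $[0,\infty)$ to the set of positive Borel measures on $\mathbb T$ such that $\mu_t(\mathbb T)$ is uniformly bounded, let $g_t$ be the solution of the associated radial Löwner equation, $f_t=g_t^{-1}:\mathbb D\to\mathbb D\setminus\mathcal K_t$, $\psi_t=\frac{f_t}{1-f_t}$, and let $\nu_t$ be the unique probability measure on $\mathbb T$ such that $\psi_t(z)=\int_{\mathbb T}\frac{z\zeta}{1-z\zeta}\,\nu_t(d\zeta)$ for $z\in\mathbb D$. Then for each $0\le s\le t$ there exists a conformal (injective holomorphic) map $H_{s,t}:\mathbb D\to\mathbb D$ such that $\psi_s\circ H_{s,t}=\psi_t$. The family of maps $\{H_{s,t}\}_{0\le s\le t}$ uniquely defines a Markov transition kernel $\{k_{s,t}(\xi;d\zeta)\}$ on $\mathbb T$ by $$\int_{\mathbb T}\frac{z\zeta}{1-z\zeta}\,k_{s,t}(\xi;d\zeta)=\frac{H_{s,t}(z)\xi}{1-H_{s,t}(z)\xi},\qquad z\in\mathbb D,\ \xi\in\mathbb T.$$ Furthermore, $\nu_t(d\zeta)=k_{0,t}(1;d\zeta)$ for each $t\ge0$.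
   Context: Notation: $\mathbb D$ is the open unit disk, $\mathbb T=\{z\in\mathbb C:|z|=1\}$; measures on $\mathbb T$ carry the weak topology. Measures on $\mathbb T$ are identified with measures on $[0,2\pi)$ through $\zeta=e^{-i\theta}$, so that $\int_0^{2\pi}\frac{ze^{-i\theta}}{1-ze^{-i\theta}}\,\mu(d\theta)=\int_{\mathbb T}\frac{z\zeta}{1-z\zeta}\,\mu(d\zeta)=\sum_{n\ge1}z^n\int_{\mathbb T}\zeta^n\mu(d\zeta)$. For $z\in\mathbb D$ let $g_t(z)$ solve the radial Löwner equation $$\partial_t g_t(z)=g_t(z)\int_0^{2\pi}\frac{e^{i\theta}+g_t(z)}{e^{i\theta}-g_t(z)}\,\mu_t(d\theta),\qquad g_0(z)=z,$$ up to its maximal existence time $T_z\in(0,\infty]$, and let $\mathcal K_t$ be the closure of $\{z\in\mathbb D:T_z\le t\}$. Then $g_t$ is a conformal map of $\mathbb D\setminus\mathcal K_t$ onto $\mathbb D$ with $g_t(0)=0$ and $g_t'(0)>0$; its inverse is $f_t$. A Markov transition kernel on $\mathbb T$ is a family $\{k_{s,t}(\xi;d\zeta)\}_{0\le s\le t,\,\xi\in\mathbb T}$ of Borel probability measures on $\mathbb T$, measurable in $\xi$, with $k_{t,t}(\xi;\cdot)=\delta_\xi$ and $k_{s,t}(\xi;d\zeta)=\int_{\mathbb T}k_{s,r}(\xi;d\eta)\,k_{r,t}(\eta;d\zeta)$ for $0\le s\le r\le t$. *)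

theory Defs
  imports "HOL-Probability.Probability"
begin

definition circle :: "complex measure" where
  "circle = restrict_space borel (sphere 0 1)"

definition circle_measures :: "complex measure set" where
  "circle_measures = {m. sets m = sets circle \<and> finite_measure m}"

text \<open>Weak convergence of measures on the circle. The library's notion of weak convergence
  only covers measures on the real line.\<close>

definition weak_tendsto ::
    "('a \<Rightarrow> complex measure) \<Rightarrow> complex measure \<Rightarrow> 'a filter \<Rightarrow> bool" where
  "weak_tendsto \<mu> m F \<longleftrightarrow>
     (\<forall>\<phi> :: complex \<Rightarrow> real. continuous_on (sphere 0 1) \<phi> \<longrightarrow>
        ((\<lambda>t. \<integral>\<zeta>. \<phi> \<zeta> \<partial>\<mu> t) \<longlongrightarrow> (\<integral>\<zeta>. \<phi> \<zeta> \<partial>m)) F)"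

definition weakly_continuous_at :: "(real \<Rightarrow> complex measure) \<Rightarrow> real \<Rightarrow> bool" where
  "weakly_continuous_at \<mu> t \<longleftrightarrow> weak_tendsto \<mu> (\<mu> t) (at t within {0..})"

definition piecewise_weakly_continuous :: "(real \<Rightarrow> complex measure) \<Rightarrow> bool" where
  "piecewise_weakly_continuous \<mu> \<longleftrightarrow>
     (\<forall>a. finite {t \<in> {0..a}. \<not> weakly_continuous_at \<mu> t}) \<and>
     (\<forall>t\<ge>0. \<exists>m\<in>circle_measures. weak_tendsto \<mu> m (at_right t)) \<and>
     (\<forall>t>0. \<exists>m\<in>circle_measures. weak_tendsto \<mu> m (at_left t))"

text \<open>A measure on \<open>[0, 2\<pi>)\<close> is identified with a measure on the circle through
  \<open>\<zeta> = exp (-i\<theta>)\<close>, so \<open>exp (i\<theta>)\<close> becomes \<open>cnj \<zeta>\<close>.\<close>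

definition loewner_field :: "complex measure \<Rightarrow> complex \<Rightarrow> complex" where
  "loewner_field m w = w * (\<integral>\<zeta>. (cnj \<zeta> + w) / (cnj \<zeta> - w) \<partial>m)"

text \<open>A solution in the disk on \<open>[0, \<tau>)\<close>. It is continuous, and the differential equation is
  imposed at the continuity points of \<open>\<mu>\<close> only, since a solution need not be differentiable
  at a jump of \<open>\<mu>\<close>. The derivative at \<open>0\<close> is one-sided.\<close>

definition loewner_solution ::
    "(real \<Rightarrow> complex measure) \<Rightarrow> complex \<Rightarrow> ereal \<Rightarrow> (real \<Rightarrow> complex) \<Rightarrow> bool" where
  "loewner_solution \<mu> z \<tau> \<gamma> \<longleftrightarrow>
     \<gamma> 0 = z \<and>
     continuous_on {t. 0 \<le> t \<and> ereal t < \<tau>} \<gamma> \<and>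
     (\<forall>t. 0 \<le> t \<and> ereal t < \<tau> \<longrightarrow> \<gamma> t \<in> ball 0 1) \<and>
     (\<forall>t. 0 \<le> t \<and> ereal t < \<tau> \<and> weakly_continuous_at \<mu> t \<longrightarrow>
        (\<gamma> has_vector_derivative loewner_field (\<mu> t) (\<gamma> t)) (at t within {0..}))"

definition maximal_loewner_solution ::
    "(real \<Rightarrow> complex measure) \<Rightarrow> complex \<Rightarrow> ereal \<Rightarrow> (real \<Rightarrow> complex) \<Rightarrow> bool" where
  "maximal_loewner_solution \<mu> z \<tau> \<gamma> \<longleftrightarrow>
     0 < \<tau> \<and> loewner_solution \<mu> z \<tau> \<gamma> \<and>
     (\<forall>\<tau>' \<gamma>'. loewner_solution \<mu> z \<tau>' \<gamma>' \<longrightarrow> \<tau>' \<le> \<tau>)"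

definition loewner_hull :: "(complex \<Rightarrow> ereal) \<Rightarrow> real \<Rightarrow> complex set" where
  "loewner_hull T t = closure {z \<in> ball 0 1. T z \<le> ereal t}"

definition loewner_inverse ::
    "(real \<Rightarrow> complex \<Rightarrow> complex) \<Rightarrow> (complex \<Rightarrow> ereal) \<Rightarrow> real \<Rightarrow> complex \<Rightarrow> complex" where
  "loewner_inverse g T t = inv_into (ball 0 1 - loewner_hull T t) (g t)"

definition loewner_psi ::
    "(real \<Rightarrow> complex \<Rightarrow> complex) \<Rightarrow> (complex \<Rightarrow> ereal) \<Rightarrow> real \<Rightarrow> complex \<Rightarrow> complex" where
  "loewner_psi g T t z = loewner_inverse g T t z / (1 - loewner_inverse g T t z)"

definition represents :: "complex measure \<Rightarrow> (complex \<Rightarrow> complex) \<Rightarrow> bool" where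
  "represents \<kappa> F \<longleftrightarrow>
     \<kappa> \<in> space (prob_algebra circle) \<and>
     (\<forall>z\<in>ball 0 1. (\<integral>\<zeta>. z * \<zeta> / (1 - z * \<zeta>) \<partial>\<kappa>) = F z)"

definition representing_measure :: "(complex \<Rightarrow> complex) \<Rightarrow> complex measure" where
  "representing_measure F = (THE \<nu>. represents \<nu> F)"

definition transition_map :: "(complex \<Rightarrow> complex) \<Rightarrow> (complex \<Rightarrow> complex) \<Rightarrow> (complex \<Rightarrow> complex) \<Rightarrow> bool" where
  "transition_map F G h \<longleftrightarrow>
     h holomorphic_on ball 0 1 \<and> inj_on h (ball 0 1) \<and> h ` ball 0 1 \<subseteq> ball 0 1 \<and>
     (\<forall>z\<in>ball 0 1. F (h z) = G z)"

text \<open>Measurability into \<open>prob_algebra circle\<close> says that the measures \<open>k s t \<xi>\<close> are Borel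
  probability measures on the circle depending measurably on \<open>\<xi>\<close>.\<close>

definition markov_kernel :: "(real \<Rightarrow> real \<Rightarrow> complex \<Rightarrow> complex measure) \<Rightarrow> bool" where
  "markov_kernel k \<longleftrightarrow>
     (\<forall>s t. 0 \<le> s \<and> s \<le> t \<longrightarrow> k s t \<in> circle \<rightarrow>\<^sub>M prob_algebra circle) \<and>
     (\<forall>t\<ge>0. \<forall>\<xi>\<in>sphere 0 1. k t t \<xi> = return circle \<xi>) \<and>
     (\<forall>s r t. 0 \<le> s \<and> s \<le> r \<and> r \<le> t \<longrightarrow>
        (\<forall>\<xi>\<in>sphere 0 1. k s t \<xi> = k s r \<xi> \<bind> k r t))"

end

theory Submission
  imports Defs "HOL-Complex_Analysis.Complex_Analysis"
begin

text \<open>The Loewner equation is solved backwards in time. Write the vector field as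
\<open>V\<^sub>s(z) = z p\<^sub>s(z)\<close>, where \<open>Re p\<^sub>s \<ge> 0\<close>. A solution that ends at \<open>w\<close> at time \<open>t\<close> satisfies
\<open>\<gamma>(s) = w exp (- \<integral>\<^sub>s\<^sup>t p\<^sub>u(\<gamma>(u)) du)\<close>, so \<open>\<bar>\<gamma>(s)\<bar> \<le> \<bar>w\<bar>\<close>: going backwards it cannot leave the disk, and
the Picard iteration for this integral equation converges on all of \<open>[0, t]\<close>
(\<open>backward_curve_exists\<close>). This defines maps \<open>\<phi>\<^sub>s\<^sub>t\<close> of the disk into itself, called \<open>backflow s t\<close>
below, with \<open>\<phi>\<^sub>r\<^sub>s \<circ> \<phi>\<^sub>s\<^sub>t = \<phi>\<^sub>r\<^sub>t\<close>.

Everything else about these maps comes from one identity. The vector field has an explicit divided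
difference, \<open>V\<^sub>s(z) - V\<^sub>s(w) = (z - w) q\<^sub>s(z, w)\<close>, so the difference of two solutions solves a
scalar linear equation and
\<open>\<gamma>(a) - \<delta>(a) = (\<gamma>(b) - \<delta>(b)) exp (- \<integral>\<^sub>a\<^sup>b q\<^sub>u(\<gamma>(u), \<delta>(u)) du)\<close> (\<open>loewner_curve_diff\<close>). This
gives uniqueness in both time directions, the injectivity of \<open>\<phi>\<^sub>s\<^sub>t\<close>, and, by letting the end points
merge, its complex differentiability. The jumps of the driving measure do no harm, since only
finitely many of them lie in a bounded interval and all curves are continuous across them.

The point \<open>\<phi>\<^sub>0\<^sub>t(w)\<close> is carried to \<open>w\<close> by the forward flow. Its lifetime exceeds \<open>t\<close> because \<open>w\<close> itself lies in the image of
\<open>\<phi>\<^sub>t\<^sub>u\<close> for some \<open>u > t\<close>, by Brouwer's fixed point theorem (\<open>backflow_extend\<close>). Hence \<open>\<phi>\<^sub>0\<^sub>t\<close> maps the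
disk onto the set of points that live longer than \<open>t\<close>. This set is therefore open, so it is the
disk without the hull, and \<open>f\<^sub>t = \<phi>\<^sub>0\<^sub>t\<close>. Now \<open>f\<^sub>s \<circ> \<phi>\<^sub>s\<^sub>t = f\<^sub>t\<close>, and since \<open>f\<^sub>s\<close> and \<open>z/(1-z)\<close> are
injective, \<open>\<phi>\<^sub>s\<^sub>t\<close> is the only solution \<open>H\<^sub>s\<^sub>t\<close> of \<open>\<psi>\<^sub>s \<circ> H\<^sub>s\<^sub>t = \<psi>\<^sub>t\<close>.

On the side of measures, every holomorphic self-map \<open>h\<close> of the disk with \<open>h(0) = 0\<close> has a
kernel. For \<open>\<bar>\<xi>\<bar> = 1\<close> the function \<open>h\<xi>/(1 - h\<xi>)\<close> has real part at least \<open>-1/2\<close> and vanishes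
at \<open>0\<close>, so it is represented by a probability measure on the circle
(\<open>Herglotz_representation\<close>), which is unique (\<open>represents_unique\<close>) and depends measurably on \<open>\<xi>\<close>
(\<open>kernel_measurable\<close>). Integrating the represented function of a second kernel against the first
one composes the self-maps, so composition of kernels corresponds to composition of self-maps
(\<open>self_map_kernel_comp\<close>), and the Chapman-Kolmogorov equation is the identity
\<open>\<phi>\<^sub>s\<^sub>r \<circ> \<phi>\<^sub>r\<^sub>t = \<phi>\<^sub>s\<^sub>t\<close>.\<close>

section \<open>Continuous functions on the circle\<close>

lemma space_circle [simp]: "space circle = sphere 0 1"
  by (simp add: circle_def space_restrict_space)

lemma borel_measurable_circle_continuous:
  fixes \<phi> :: "complex \<Rightarrow> 'b :: topological_space"
  assumes "continuous_on (sphere 0 1) \<phi>" "sets m = sets circle"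
  shows "\<phi> \<in> borel_measurable m"
  using borel_measurable_continuous_on_restrict[OF assms(1)] assms(2)
  by (simp add: circle_def cong: measurable_cong_sets)

lemma space_eq_sphere: "sets m = sets circle \<Longrightarrow> space m = sphere 0 1"
  using sets_eq_imp_space_eq[of m circle] by simp

lemma continuous_on_sphere_bounded:
  fixes \<phi> :: "complex \<Rightarrow> 'b :: real_normed_vector"
  assumes "continuous_on (sphere 0 1) \<phi>"
  obtains B where "\<And>\<zeta>. \<zeta> \<in> sphere 0 1 \<Longrightarrow> norm (\<phi> \<zeta>) \<le> B"
proof -
  have "bounded (\<phi> ` sphere 0 1)"
    by (rule compact_imp_bounded[OF compact_continuous_image[OF assms compact_sphere]])
  then show thesis
    using that unfolding bounded_iff by (metis imageI)
qed

lemma integrable_circle_continuous: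
  fixes \<phi> :: "complex \<Rightarrow> 'b :: {banach, second_countable_topology}"
  assumes "continuous_on (sphere 0 1) \<phi>" "sets m = sets circle" "finite_measure m"
  shows "integrable m \<phi>"
proof -
  obtain B where "\<And>\<zeta>. \<zeta> \<in> sphere 0 1 \<Longrightarrow> norm (\<phi> \<zeta>) \<le> B"
    using continuous_on_sphere_bounded[OF assms(1)] by blast
  then show ?thesis
    using space_eq_sphere[OF assms(2)]
    by (intro finite_measure.integrable_const_bound[OF assms(3), of _ B]
          borel_measurable_circle_continuous assms AE_I2) auto
qed

lemma norm_circle_integral_le:
  fixes \<phi> :: "complex \<Rightarrow> 'b :: {banach, second_countable_topology}"
  assumes "continuous_on (sphere 0 1) \<phi>" "sets m = sets circle" "finite_measure m"
    and B: "\<And>\<zeta>. \<zeta> \<in> sphere 0 1 \<Longrightarrow> norm (\<phi> \<zeta>) \<le> B"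
  shows "norm (\<integral>\<zeta>. \<phi> \<zeta> \<partial>m) \<le> B * measure m (sphere 0 1)"
proof -
  interpret finite_measure m by fact
  have "norm (\<integral>\<zeta>. \<phi> \<zeta> \<partial>m) \<le> (\<integral>\<zeta>. norm (\<phi> \<zeta>) \<partial>m)"
    by (rule integral_norm_bound)
  also have "\<dots> \<le> (\<integral>\<zeta>. B \<partial>m)"
    using assms space_eq_sphere[OF assms(2)]
    by (intro integral_mono integrable_norm integrable_circle_continuous) auto
  also have "\<dots> = B * measure m (sphere 0 1)"
    using space_eq_sphere[OF assms(2)] by simp
  finally show ?thesis .
qed

lemma circle_integral_cong:
  fixes f g :: "complex \<Rightarrow> 'b :: {banach, second_countable_topology}"
  assumes "sets m = sets circle" "\<And>\<zeta>. norm \<zeta> = 1 \<Longrightarrow> f \<zeta> = g \<zeta>"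
  shows "(\<integral>\<zeta>. f \<zeta> \<partial>m) = (\<integral>\<zeta>. g \<zeta> \<partial>m)"
  using assms space_eq_sphere[OF assms(1)]
  by (intro Bochner_Integration.integral_cong) auto

lemma one_minus_mult_circle_neq_0: "norm (z::complex) < 1 \<Longrightarrow> norm \<zeta> = 1 \<Longrightarrow> 1 - z * \<zeta> \<noteq> 0"
  by (metis eq_iff_diff_eq_0 mult.right_neutral norm_mult norm_one order_less_irrefl)

lemma norm_one_minus_mult_circle_ge:
  "norm (\<zeta>::complex) = 1 \<Longrightarrow> 1 - norm z \<le> norm (1 - z * \<zeta>)"
  using norm_triangle_ineq2[of 1 "z * \<zeta>"] by (simp add: norm_mult)

section \<open>Trigonometric polynomials\<close>

text \<open>Negative frequencies are absent because conjugation turns them into positive ones inside the real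
part. This uses \<open>cnj \<zeta> = 1/\<zeta>\<close>, so the set is closed under multiplication only up to
equality on the circle.\<close>
inductive_set trig_poly :: "(complex \<Rightarrow> real) set" where
  monomial: "(\<lambda>\<zeta>. Re (c * \<zeta> ^ n)) \<in> trig_poly"
| add: "p \<in> trig_poly \<Longrightarrow> q \<in> trig_poly \<Longrightarrow> (\<lambda>\<zeta>. p \<zeta> + q \<zeta>) \<in> trig_poly"

lemma continuous_on_trig_poly: "p \<in> trig_poly \<Longrightarrow> continuous_on S p"
  by (induction rule: trig_poly.induct) (auto intro!: continuous_intros)

lemma trig_poly_mult_monomials:
  "\<exists>r\<in>trig_poly. \<forall>\<zeta>. norm \<zeta> = 1 \<longrightarrow> Re (c * \<zeta> ^ n) * Re (d * \<zeta> ^ m) = r \<zeta>"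
proof -
  have *: "\<exists>r\<in>trig_poly. \<forall>\<zeta>. norm \<zeta> = 1 \<longrightarrow> Re (c * \<zeta> ^ n) * Re (d * \<zeta> ^ m) = r \<zeta>"
    if "m \<le> n" for c d n m
  proof (intro bexI allI impI)
    show "(\<lambda>\<zeta>. Re (c * d / 2 * \<zeta> ^ (n + m)) + Re (c * cnj d / 2 * \<zeta> ^ (n - m))) \<in> trig_poly"
      by (intro trig_poly.intros)
    fix \<zeta> :: complex assume \<zeta>: "norm \<zeta> = 1"
    have "\<zeta> ^ n * cnj (\<zeta> ^ m) = \<zeta> ^ (n - m) * (\<zeta> ^ m * cnj (\<zeta> ^ m))"
      using that by (simp flip: power_add mult.assoc)
    also have "\<dots> = \<zeta> ^ (n - m)"
      using \<zeta> by (subst complex_norm_square[symmetric]) (simp add: norm_power)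
    finally have "c * cnj d / 2 * \<zeta> ^ (n - m) = (c * \<zeta> ^ n) * cnj (d * \<zeta> ^ m) / 2"
      by simp
    moreover have "c * d / 2 * \<zeta> ^ (n + m) = (c * \<zeta> ^ n) * (d * \<zeta> ^ m) / 2"
      by (simp add: power_add)
    moreover have "Re a * Re b = Re (a * b / 2) + Re (a * cnj b / 2)" for a b
      by (simp add: field_simps)
    ultimately show "Re (c * \<zeta> ^ n) * Re (d * \<zeta> ^ m) =
        Re (c * d / 2 * \<zeta> ^ (n + m)) + Re (c * cnj d / 2 * \<zeta> ^ (n - m))"
      by metis
  qed
  show ?thesis
    using *[of m n c d] *[of n m d c] by (cases "m \<le> n") (auto simp: mult.commute)
qed

lemma trig_poly_mult:
  assumes "p \<in> trig_poly" "q \<in> trig_poly"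
  shows "\<exists>r\<in>trig_poly. \<forall>\<zeta>. norm \<zeta> = 1 \<longrightarrow> p \<zeta> * q \<zeta> = r \<zeta>"
  using assms(1)
proof (induction rule: trig_poly.induct)
  case (monomial c n)
  show ?case
    using assms(2)
  proof (induction rule: trig_poly.induct)
    case (monomial d m)
    show ?case by (rule trig_poly_mult_monomials)
  next
    case (add p q)
    then obtain r s where "r \<in> trig_poly" "s \<in> trig_poly"
      "\<forall>\<zeta>. norm \<zeta> = 1 \<longrightarrow> Re (c * \<zeta> ^ n) * p \<zeta> = r \<zeta>" "\<forall>\<zeta>. norm \<zeta> = 1 \<longrightarrow> Re (c * \<zeta> ^ n) * q \<zeta> = s \<zeta>"
      by blast
    then show ?case
      by (intro bexI[OF _ trig_poly.add[of r s]]) (simp_all add: distrib_left del: times_complex.sel)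
  qed
next
  case (add p1 p2)
  then obtain r s where "r \<in> trig_poly" "s \<in> trig_poly"
    "\<forall>\<zeta>. norm \<zeta> = 1 \<longrightarrow> p1 \<zeta> * q \<zeta> = r \<zeta>" "\<forall>\<zeta>. norm \<zeta> = 1 \<longrightarrow> p2 \<zeta> * q \<zeta> = s \<zeta>"
    by blast
  then show ?case
    by (intro bexI[OF _ trig_poly.add[of r s]]) (simp_all add: distrib_right del: times_complex.sel)
qed

text \<open>Together with all functions on the plane that agree with one of them on the circle, the
trigonometric polynomials form an algebra that separates points, so Stone-Weierstrass applies.\<close>
lemma trig_poly_uniformly_dense:
  fixes \<phi> :: "complex \<Rightarrow> real"
  assumes "continuous_on (sphere 0 1) \<phi>"
  obtains P where "\<And>n. P n \<in> trig_poly" "uniform_limit (sphere 0 1) P \<phi> sequentially"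
proof -
  define R :: "(complex \<Rightarrow> real) set"
    where "R = {f. \<exists>p\<in>trig_poly. \<forall>\<zeta>. norm \<zeta> = 1 \<longrightarrow> f \<zeta> = p \<zeta>}"
  have trig_R: "p \<in> R" if "p \<in> trig_poly" for p
    using that by (auto simp: R_def)
  interpret function_ring_on R "sphere 0 1"
  proof
    show "compact (sphere (0::complex) 1)" by simp
    show "continuous_on (sphere 0 1) f" if f: "f \<in> R" for f
    proof -
      obtain p where p: "p \<in> trig_poly" "\<forall>\<zeta>. norm \<zeta> = 1 \<longrightarrow> f \<zeta> = p \<zeta>"
        using f unfolding R_def by blast
      then show ?thesis
        by (subst continuous_on_cong[OF refl, of _ _ p]) (auto intro: continuous_on_trig_poly)
    qed
    show "(\<lambda>x. f x + g x) \<in> R" if fg: "f \<in> R" "g \<in> R" for f g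
    proof -
      obtain p q where "p \<in> trig_poly" "\<forall>\<zeta>. norm \<zeta> = 1 \<longrightarrow> f \<zeta> = p \<zeta>"
          "q \<in> trig_poly" "\<forall>\<zeta>. norm \<zeta> = 1 \<longrightarrow> g \<zeta> = q \<zeta>"
        using fg unfolding R_def by blast
      then show ?thesis
        unfolding R_def mem_Collect_eq by (intro bexI[OF _ trig_poly.add[of p q]]) simp_all
    qed
    show "(\<lambda>x. f x * g x) \<in> R" if fg: "f \<in> R" "g \<in> R" for f g
    proof -
      obtain p q where pq: "p \<in> trig_poly" "\<forall>\<zeta>. norm \<zeta> = 1 \<longrightarrow> f \<zeta> = p \<zeta>"
          "q \<in> trig_poly" "\<forall>\<zeta>. norm \<zeta> = 1 \<longrightarrow> g \<zeta> = q \<zeta>"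
        using fg unfolding R_def by blast
      obtain r where "r \<in> trig_poly" "\<forall>\<zeta>. norm \<zeta> = 1 \<longrightarrow> p \<zeta> * q \<zeta> = r \<zeta>"
        using trig_poly_mult[OF pq(1,3)] by blast
      then show ?thesis
        unfolding R_def mem_Collect_eq using pq by (intro bexI[of _ r]) auto
    qed
    show "(\<lambda>_. c) \<in> R" for c
      using trig_R[OF trig_poly.monomial[of "of_real c" 0]] by simp
    show "\<exists>f\<in>R. f x \<noteq> f y" if "x \<noteq> y" for x y
    proof (cases "Re x = Re y")
      case False
      then show ?thesis
        using trig_R[OF trig_poly.monomial[of 1 1]] by (intro bexI[of _ Re]) auto
    next
      case True
      then have "Im x \<noteq> Im y" using that by (simp add: complex_eq_iff)
      then show ?thesis
        using trig_R[OF trig_poly.monomial[of "-\<i>" 1]] by (intro bexI[of _ Im]) auto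
    qed
  qed
  obtain F where F: "\<And>n. F n \<in> R" "uniform_limit (sphere 0 1) F \<phi> sequentially"
    using Stone_Weierstrass[OF assms] by blast
  then have "\<forall>n. \<exists>p\<in>trig_poly. \<forall>\<zeta>. norm \<zeta> = 1 \<longrightarrow> F n \<zeta> = p \<zeta>"
    by (auto simp: R_def)
  then obtain P where P: "\<And>n. P n \<in> trig_poly" "\<And>n \<zeta>. norm \<zeta> = 1 \<Longrightarrow> F n \<zeta> = P n \<zeta>"
    by metis
  have "uniform_limit (sphere 0 1) P \<phi> sequentially"
    using F(2) by (rule uniform_limit_cong'[THEN iffD1, rotated -1]) (auto simp: P)
  then show thesis using that P by blast
qed

section \<open>Cauchy transforms determine measures on the circle\<close>

lemma sets_circle_generated: "sets circle = sigma_sets (sphere 0 1) ((\<inter>) (sphere 0 1) ` {A. closed A})"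
proof -
  have "sets circle = (\<inter>) (sphere 0 1) ` sigma_sets UNIV {A::complex set. closed A}"
    by (simp add: circle_def sets_restrict_space borel_eq_closed)
  also have "\<dots> = sigma_sets (sphere 0 1) ((\<inter>) (sphere 0 1) ` {A. closed A})"
    by (rule sigma_sets_Int) auto
  finally show ?thesis .
qed

text \<open>A family of probability measures \<open>\<kappa> x\<close> on the circle whose Cauchy transforms depend measurably
on \<open>x\<close> is itself measurable in \<open>x\<close>. Measurability passes from the Cauchy transforms to the
moments, from there to integrals of trigonometric polynomials, to integrals of continuous
functions, and finally to the measure of closed sets. The parameter space is kept abstract because
the same result, applied to a two-point space, also yields uniqueness.\<close>
context
  fixes \<kappa> :: "'x \<Rightarrow> complex measure" and M :: "'x measure"
  assumes prob: "\<And>x. x \<in> space M \<Longrightarrow> \<kappa> x \<in> space (prob_algebra circle)"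
    and meas: "\<And>z. z \<in> ball 0 1 \<Longrightarrow> (\<lambda>x. \<integral>\<zeta>. z * \<zeta> / (1 - z * \<zeta>) \<partial>\<kappa> x) \<in> borel_measurable M"
begin

lemma kernel_sets: "x \<in> space M \<Longrightarrow> sets (\<kappa> x) = sets circle"
  and kernel_prob: "x \<in> space M \<Longrightarrow> prob_space (\<kappa> x)"
  and kernel_finite: "x \<in> space M \<Longrightarrow> finite_measure (\<kappa> x)"
  using prob by (auto simp: space_prob_algebra intro: prob_space.finite_measure)

lemma kernel_integrable:
  fixes \<phi> :: "complex \<Rightarrow> 'b :: {banach, second_countable_topology}"
  shows "x \<in> space M \<Longrightarrow> continuous_on (sphere 0 1) \<phi> \<Longrightarrow> integrable (\<kappa> x) \<phi>"
  by (intro integrable_circle_continuous kernel_sets kernel_finite)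

lemma kernel_norm_le:
  fixes \<phi> :: "complex \<Rightarrow> 'b :: {banach, second_countable_topology}"
  assumes "x \<in> space M" "continuous_on (sphere 0 1) \<phi>" "\<And>\<zeta>. \<zeta> \<in> sphere 0 1 \<Longrightarrow> norm (\<phi> \<zeta>) \<le> B"
  shows "norm (\<integral>\<zeta>. \<phi> \<zeta> \<partial>\<kappa> x) \<le> B"
  using norm_circle_integral_le[OF assms(2) kernel_sets[OF assms(1)] kernel_finite[OF assms(1)] assms(3)]
    prob_space.prob_space[OF kernel_prob[OF assms(1)]] space_eq_sphere[OF kernel_sets[OF assms(1)]]
  by simp

text \<open>The moments are the Taylor coefficients of the Cauchy transform and can be read off one after
another: \<open>R\<^sub>n(z) = \<integral> \<zeta>\<^sup>n/(1 - z\<zeta>) d\<kappa>\<close> satisfies \<open>R\<^sub>n\<^sub>+\<^sub>1(z) = (R\<^sub>n(z) - m\<^sub>n)/z\<close>, and the moment \<open>m\<^sub>n\<close>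
is the limit of \<open>R\<^sub>n(z)\<close> as \<open>z\<close> tends to \<open>0\<close>. The induction carries \<open>R\<^sub>n\<close> and \<open>m\<^sub>n\<close> together.\<close>
lemma moment_tail_measurable:
  "(\<forall>z\<in>ball 0 1 - {0}. (\<lambda>x. \<integral>\<zeta>. \<zeta> ^ n / (1 - z * \<zeta>) \<partial>\<kappa> x) \<in> borel_measurable M) \<and>
   (\<lambda>x. \<integral>\<zeta>. \<zeta> ^ n \<partial>\<kappa> x) \<in> borel_measurable M"
proof (induction n)
  case 0
  have "(\<lambda>x. \<integral>\<zeta>. \<zeta> ^ 0 / (1 - z * \<zeta>) \<partial>\<kappa> x) \<in> borel_measurable M" if z: "z \<in> ball 0 1 - {0}" for z
  proof -
    have "(\<integral>\<zeta>. \<zeta> ^ 0 / (1 - z * \<zeta>) \<partial>\<kappa> x) = 1 + (\<integral>\<zeta>. z * \<zeta> / (1 - z * \<zeta>) \<partial>\<kappa> x)"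
      if x: "x \<in> space M" for x
    proof -
      interpret prob_space "\<kappa> x" by (rule kernel_prob[OF x])
      have "(\<integral>\<zeta>. \<zeta> ^ 0 / (1 - z * \<zeta>) \<partial>\<kappa> x) = (\<integral>\<zeta>. 1 + z * \<zeta> / (1 - z * \<zeta>) \<partial>\<kappa> x)"
        using z by (intro circle_integral_cong[OF kernel_sets[OF x]])
          (auto simp: divide_simps dest: one_minus_mult_circle_neq_0)
      also have "\<dots> = (\<integral>\<zeta>. 1 \<partial>\<kappa> x) + (\<integral>\<zeta>. z * \<zeta> / (1 - z * \<zeta>) \<partial>\<kappa> x)"
        using z by (intro Bochner_Integration.integral_add kernel_integrable x continuous_intros)
          (auto dest: one_minus_mult_circle_neq_0)
      finally show ?thesis by (simp add: prob_space)
    qed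
    note eq = this
    have "(\<lambda>x. 1 + (\<integral>\<zeta>. z * \<zeta> / (1 - z * \<zeta>) \<partial>\<kappa> x)) \<in> borel_measurable M"
      using meas[of z] z by (intro borel_measurable_add) auto
    then show ?thesis
      using measurable_cong[of M "\<lambda>x. \<integral>\<zeta>. \<zeta> ^ 0 / (1 - z * \<zeta>) \<partial>\<kappa> x", OF eq] by blast
  qed
  moreover have "(\<lambda>x. \<integral>\<zeta>. \<zeta> ^ 0 \<partial>\<kappa> x) \<in> borel_measurable M"
    using prob_space.prob_space[OF kernel_prob] by (subst measurable_cong[of _ _ "\<lambda>_. 1"]) auto
  ultimately show ?case by blast
next
  case (Suc n)
  have tail: "(\<lambda>x. \<integral>\<zeta>. \<zeta> ^ Suc n / (1 - z * \<zeta>) \<partial>\<kappa> x) \<in> borel_measurable M"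
    if z: "z \<in> ball 0 1 - {0}" for z
  proof -
    have "(\<integral>\<zeta>. \<zeta> ^ Suc n / (1 - z * \<zeta>) \<partial>\<kappa> x) =
        ((\<integral>\<zeta>. \<zeta> ^ n / (1 - z * \<zeta>) \<partial>\<kappa> x) - (\<integral>\<zeta>. \<zeta> ^ n \<partial>\<kappa> x)) / z"
      if x: "x \<in> space M" for x
    proof -
      have "(\<integral>\<zeta>. \<zeta> ^ Suc n / (1 - z * \<zeta>) \<partial>\<kappa> x) = (\<integral>\<zeta>. (\<zeta> ^ n / (1 - z * \<zeta>) - \<zeta> ^ n) / z \<partial>\<kappa> x)"
        using z by (intro circle_integral_cong[OF kernel_sets[OF x]])
          (auto simp: field_simps dest: one_minus_mult_circle_neq_0)
      also have "\<dots> = ((\<integral>\<zeta>. \<zeta> ^ n / (1 - z * \<zeta>) \<partial>\<kappa> x) - (\<integral>\<zeta>. \<zeta> ^ n \<partial>\<kappa> x)) / z"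
        unfolding integral_divide_zero
        using z by (subst Bochner_Integration.integral_diff)
          (auto intro!: kernel_integrable x continuous_intros dest: one_minus_mult_circle_neq_0)
      finally show ?thesis .
    qed
    note eq = this
    have "(\<lambda>x. ((\<integral>\<zeta>. \<zeta> ^ n / (1 - z * \<zeta>) \<partial>\<kappa> x) - (\<integral>\<zeta>. \<zeta> ^ n \<partial>\<kappa> x)) / z) \<in> borel_measurable M"
      using Suc z by (intro borel_measurable_divide borel_measurable_diff borel_measurable_const) blast+
    then show ?thesis
      using measurable_cong[of M "\<lambda>x. \<integral>\<zeta>. \<zeta> ^ Suc n / (1 - z * \<zeta>) \<partial>\<kappa> x", OF eq] by blast
  qed
  define z where "z j = complex_of_real (1 / real (j + 2))" for j
  have z: "z j \<in> ball 0 1 - {0}" for j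
    by (simp add: z_def norm_divide del: of_real_add)
  have "(\<lambda>x. \<integral>\<zeta>. \<zeta> ^ Suc n \<partial>\<kappa> x) \<in> borel_measurable M"
  proof (rule borel_measurable_LIMSEQ_metric)
    show "(\<lambda>x. \<integral>\<zeta>. \<zeta> ^ Suc n / (1 - z j * \<zeta>) \<partial>\<kappa> x) \<in> borel_measurable M" for j
      by (rule tail[OF z])
    fix x assume x: "x \<in> space M"
    have bd: "norm ((\<integral>\<zeta>. \<zeta> ^ Suc n / (1 - z j * \<zeta>) \<partial>\<kappa> x) - (\<integral>\<zeta>. \<zeta> ^ Suc n \<partial>\<kappa> x)) \<le> 1 / real (Suc j)" for j
    proof -
      have "(\<integral>\<zeta>. \<zeta> ^ Suc n / (1 - z j * \<zeta>) \<partial>\<kappa> x) - (\<integral>\<zeta>. \<zeta> ^ Suc n \<partial>\<kappa> x) =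
        (\<integral>\<zeta>. \<zeta> ^ Suc n / (1 - z j * \<zeta>) - \<zeta> ^ Suc n \<partial>\<kappa> x)"
        using z[of j] by (subst Bochner_Integration.integral_diff)
          (auto intro!: kernel_integrable x continuous_intros dest: one_minus_mult_circle_neq_0 simp del: power_Suc)
      also have "norm \<dots> \<le> 1 / real (Suc j)"
      proof (rule kernel_norm_le[OF x])
        show "continuous_on (sphere 0 1) (\<lambda>\<zeta>. \<zeta> ^ Suc n / (1 - z j * \<zeta>) - \<zeta> ^ Suc n)"
          using z[of j] by (intro continuous_intros) (auto dest: one_minus_mult_circle_neq_0)
        fix \<zeta> :: complex assume "\<zeta> \<in> sphere 0 1"
        then have \<zeta>: "norm \<zeta> = 1" by simp
        have nz: "1 - z j * \<zeta> \<noteq> 0" using z[of j] \<zeta> by (auto dest: one_minus_mult_circle_neq_0)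
        have "\<zeta> ^ Suc n / (1 - z j * \<zeta>) - \<zeta> ^ Suc n = z j * \<zeta> ^ Suc (Suc n) / (1 - z j * \<zeta>)"
          using nz by (simp add: field_simps)
        then have "norm (\<zeta> ^ Suc n / (1 - z j * \<zeta>) - \<zeta> ^ Suc n) = norm (z j) / norm (1 - z j * \<zeta>)"
          using \<zeta> by (simp add: norm_divide norm_mult norm_power)
        also have "\<dots> \<le> norm (z j) / (1 - norm (z j))"
          using norm_one_minus_mult_circle_ge[OF \<zeta>, of "z j"] z[of j]
          by (intro divide_left_mono mult_pos_pos) (auto intro: less_le_trans)
        also have "\<dots> = 1 / real (Suc j)"
          by (simp add: z_def norm_divide field_simps del: of_real_add of_nat_add)
        finally show "norm (\<zeta> ^ Suc n / (1 - z j * \<zeta>) - \<zeta> ^ Suc n) \<le> 1 / real (Suc j)" .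
      qed
      finally show ?thesis .
    qed
    show "(\<lambda>j. \<integral>\<zeta>. \<zeta> ^ Suc n / (1 - z j * \<zeta>) \<partial>\<kappa> x) \<longlonglongrightarrow> (\<integral>\<zeta>. \<zeta> ^ Suc n \<partial>\<kappa> x)"
      by (rule LIM_zero_cancel, rule Lim_null_comparison[OF _ LIMSEQ_Suc[OF lim_1_over_n]])
        (use bd in \<open>intro always_eventually allI\<close>)
  qed
  with tail show ?case by blast
qed

lemma trig_poly_integral_measurable:
  "p \<in> trig_poly \<Longrightarrow> (\<lambda>x. \<integral>\<zeta>. p \<zeta> \<partial>\<kappa> x) \<in> borel_measurable M"
proof (induction rule: trig_poly.induct)
  case (monomial c n)
  have "(\<integral>\<zeta>. Re (c * \<zeta> ^ n) \<partial>\<kappa> x) = Re (c * (\<integral>\<zeta>. \<zeta> ^ n \<partial>\<kappa> x))" if "x \<in> space M" for x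
  proof -
    have "(\<integral>\<zeta>. Re (c * \<zeta> ^ n) \<partial>\<kappa> x) = Re (\<integral>\<zeta>. c * \<zeta> ^ n \<partial>\<kappa> x)"
      by (intro integral_Re kernel_integrable that continuous_intros)
    then show ?thesis by simp
  qed
  then show ?case
    using moment_tail_measurable[of n] by (subst measurable_cong[of _ _ "\<lambda>x. Re (c * (\<integral>\<zeta>. \<zeta> ^ n \<partial>\<kappa> x))"]) auto
next
  case (add p q)
  have "(\<integral>\<zeta>. p \<zeta> + q \<zeta> \<partial>\<kappa> x) = (\<integral>\<zeta>. p \<zeta> \<partial>\<kappa> x) + (\<integral>\<zeta>. q \<zeta> \<partial>\<kappa> x)" if "x \<in> space M" for x
    using add that by (intro Bochner_Integration.integral_add kernel_integrable continuous_on_trig_poly)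
  then show ?case
    using add.IH by (subst measurable_cong[of _ _ "\<lambda>x. (\<integral>\<zeta>. p \<zeta> \<partial>\<kappa> x) + (\<integral>\<zeta>. q \<zeta> \<partial>\<kappa> x)"]) auto
qed

lemma continuous_integral_measurable:
  fixes \<phi> :: "complex \<Rightarrow> real"
  assumes \<phi>: "continuous_on (sphere 0 1) \<phi>"
  shows "(\<lambda>x. \<integral>\<zeta>. \<phi> \<zeta> \<partial>\<kappa> x) \<in> borel_measurable M"
proof -
  obtain P where P: "\<And>n. P n \<in> trig_poly" "uniform_limit (sphere 0 1) P \<phi> sequentially"
    using trig_poly_uniformly_dense[OF \<phi>] by blast
  show ?thesis
  proof (rule borel_measurable_LIMSEQ_metric)
    show "(\<lambda>x. \<integral>\<zeta>. P n \<zeta> \<partial>\<kappa> x) \<in> borel_measurable M" for n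
      by (rule trig_poly_integral_measurable[OF P(1)])
    fix x assume x: "x \<in> space M"
    show "(\<lambda>n. \<integral>\<zeta>. P n \<zeta> \<partial>\<kappa> x) \<longlonglongrightarrow> (\<integral>\<zeta>. \<phi> \<zeta> \<partial>\<kappa> x)"
    proof (rule tendstoI)
      fix e :: real assume e: "e > 0"
      have "\<forall>\<^sub>F n in sequentially. \<forall>\<zeta>\<in>sphere 0 1. dist (P n \<zeta>) (\<phi> \<zeta>) < e / 2"
        using e by (intro uniform_limitD[OF P(2)]) auto
      then show "\<forall>\<^sub>F n in sequentially. dist (\<integral>\<zeta>. P n \<zeta> \<partial>\<kappa> x) (\<integral>\<zeta>. \<phi> \<zeta> \<partial>\<kappa> x) < e"
      proof eventually_elim
        case (elim n)
        have "(\<integral>\<zeta>. P n \<zeta> \<partial>\<kappa> x) - (\<integral>\<zeta>. \<phi> \<zeta> \<partial>\<kappa> x) = (\<integral>\<zeta>. P n \<zeta> - \<phi> \<zeta> \<partial>\<kappa> x)"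
          by (intro Bochner_Integration.integral_diff[symmetric] kernel_integrable x \<phi> continuous_on_trig_poly P)
        also have "norm \<dots> \<le> e / 2"
          using elim by (intro kernel_norm_le x continuous_intros \<phi> continuous_on_trig_poly P)
            (auto simp: dist_norm intro: less_imp_le)
        finally show ?case using e by (simp add: dist_norm)
      qed
    qed
  qed
qed

text \<open>The indicator of a nonempty closed set \<open>A\<close> is the decreasing limit of the continuous functions
\<open>max 0 (1 - j dist(\<zeta>, A))\<close>.\<close>
lemma kernel_measure_closed_measurable:
  assumes "closed A"
  shows "(\<lambda>x. measure (\<kappa> x) (sphere 0 1 \<inter> A)) \<in> borel_measurable M"
proof (cases "A = {}")
  case False
  define \<phi> where "\<phi> j \<zeta> = max 0 (1 - real j * infdist \<zeta> A)" for j and \<zeta> :: complex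
  have cont: "continuous_on S (\<phi> j)" for j S
    unfolding \<phi>_def by (intro continuous_intros)
  show ?thesis
  proof (rule borel_measurable_LIMSEQ_metric)
    show "(\<lambda>x. \<integral>\<zeta>. \<phi> j \<zeta> \<partial>\<kappa> x) \<in> borel_measurable M" for j
      by (rule continuous_integral_measurable[OF cont])
    fix x assume x: "x \<in> space M"
    interpret prob_space "\<kappa> x" by (rule kernel_prob[OF x])
    have sp: "space (\<kappa> x) = sphere 0 1" by (rule space_eq_sphere[OF kernel_sets[OF x]])
    have A: "sphere 0 1 \<inter> A \<in> sets (\<kappa> x)"
      using assms by (auto simp: kernel_sets[OF x] sets_circle_generated)
    have "(\<lambda>j. \<integral>\<zeta>. \<phi> j \<zeta> \<partial>\<kappa> x) \<longlonglongrightarrow> (\<integral>\<zeta>. indicator (sphere 0 1 \<inter> A) \<zeta> \<partial>\<kappa> x)"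
    proof (rule integral_dominated_convergence[where w="\<lambda>_. 1"])
      show "\<phi> j \<in> borel_measurable (\<kappa> x)" for j
        by (rule borel_measurable_circle_continuous[OF cont kernel_sets[OF x]])
      show "AE \<zeta> in \<kappa> x. norm (\<phi> j \<zeta>) \<le> 1" for j
        by (simp add: \<phi>_def infdist_nonneg)
      show "AE \<zeta> in \<kappa> x. (\<lambda>j. \<phi> j \<zeta>) \<longlonglongrightarrow> indicator (sphere 0 1 \<inter> A) \<zeta>"
      proof (rule AE_I2)
        fix \<zeta> assume \<zeta>: "\<zeta> \<in> space (\<kappa> x)"
        show "(\<lambda>j. \<phi> j \<zeta>) \<longlonglongrightarrow> indicator (sphere 0 1 \<inter> A) \<zeta>"
        proof (cases "\<zeta> \<in> A")
          case True
          then show ?thesis using \<zeta> by (simp add: \<phi>_def sp)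
        next
          case nA: False
          then have pos: "infdist \<zeta> A > 0"
            using assms False by (metis in_closed_iff_infdist_zero infdist_nonneg less_eq_real_def)
          obtain N :: nat where N: "1 / infdist \<zeta> A < real N"
            using reals_Archimedean2 by blast
          have "\<phi> j \<zeta> = 0" if "j \<ge> N" for j
          proof -
            have "1 / infdist \<zeta> A < real j" using N that by linarith
            then have "1 < real j * infdist \<zeta> A" using pos by (simp add: field_simps)
            then show ?thesis by (simp add: \<phi>_def)
          qed
          then have "\<forall>\<^sub>F j in sequentially. \<phi> j \<zeta> = 0"
            unfolding eventually_sequentially by blast
          then show ?thesis using nA by (simp add: tendsto_eventually)
        qed
      qed
      show "indicator (sphere 0 1 \<inter> A) \<in> borel_measurable (\<kappa> x)"
        using A by measurable
    qed auto
    then show "(\<lambda>j. \<integral>\<zeta>. \<phi> j \<zeta> \<partial>\<kappa> x) \<longlonglongrightarrow> measure (\<kappa> x) (sphere 0 1 \<inter> A)"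
      using A sets.sets_into_space[OF A] by (simp add: Int_absorb2)
  qed
qed simp

lemma kernel_measurable: "\<kappa> \<in> M \<rightarrow>\<^sub>M prob_algebra circle"
proof (rule measurable_prob_algebra_generated[OF sets_circle_generated])
  show "Int_stable ((\<inter>) (sphere (0::complex) 1) ` {A. closed A})"
    proof (rule Int_stableI)
    fix a b :: "complex set"
    assume "a \<in> (\<inter>) (sphere 0 1) ` {A. closed A}" "b \<in> (\<inter>) (sphere 0 1) ` {A. closed A}"
    then obtain A B where "closed A" "closed B" "a = sphere 0 1 \<inter> A" "b = sphere 0 1 \<inter> B" by auto
    then show "a \<inter> b \<in> (\<inter>) (sphere 0 1) ` {A. closed A}"
      by (intro image_eqI[of _ _ "A \<inter> B"]) auto
  qed
  show "(\<inter>) (sphere (0::complex) 1) ` {A. closed A} \<subseteq> Pow (sphere 0 1)" by auto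
  show "prob_space (\<kappa> x)" "sets (\<kappa> x) = sets circle" if "x \<in> space M" for x
    using kernel_prob kernel_sets that by auto
  show "(\<lambda>x. emeasure (\<kappa> x) A) \<in> borel_measurable M" if A: "A \<in> (\<inter>) (sphere 0 1) ` {A. closed A}" for A
  proof -
    obtain B where B: "closed B" "A = sphere 0 1 \<inter> B" using A by blast
    have "(\<lambda>x. ennreal (measure (\<kappa> x) A)) \<in> borel_measurable M"
      unfolding B(2)
      by (rule measurable_compose[OF kernel_measure_closed_measurable[OF B(1)] measurable_ennreal])
    moreover have "emeasure (\<kappa> x) A = ennreal (measure (\<kappa> x) A)" if "x \<in> space M" for x
      by (rule finite_measure.emeasure_eq_measure[OF kernel_finite[OF that]])
    ultimately show ?thesis
      using measurable_cong[of M "\<lambda>x. emeasure (\<kappa> x) A" "\<lambda>x. ennreal (measure (\<kappa> x) A)"] by blast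
  qed
qed

end

text \<open>Uniqueness is measurability over a two-point space with the trivial \<open>\<sigma>\<close>-algebra, on which only
constant functions are measurable: the two measures form a measurable family there because their
Cauchy transforms agree, so they give equal mass to every set.\<close>
lemma represents_unique:
  assumes "represents \<kappa>1 F" "represents \<kappa>2 F"
  shows "\<kappa>1 = \<kappa>2"
proof -
  define M :: "bool measure" where "M = sigma UNIV {}"
  have sets_M: "sets M = {{}, UNIV}" and space_M: "space M = UNIV"
    by (auto simp: M_def sigma_sets_empty_eq)
  define \<kappa> where "\<kappa> b = (if b then \<kappa>1 else \<kappa>2)" for b
  have "\<kappa> \<in> M \<rightarrow>\<^sub>M prob_algebra circle"
  proof (rule kernel_measurable)
    show "\<kappa> b \<in> space (prob_algebra circle)" for b
      using assms by (auto simp: \<kappa>_def represents_def)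
    show "(\<lambda>b. \<integral>\<zeta>. z * \<zeta> / (1 - z * \<zeta>) \<partial>\<kappa> b) \<in> borel_measurable M" if "z \<in> ball 0 1" for z
      using assms that by (subst measurable_cong[of _ _ "\<lambda>_. F z"]) (auto simp: \<kappa>_def represents_def)
  qed
  note kernel = this
  have meas: "(\<lambda>b. measure (\<kappa> b) A) \<in> borel_measurable M" if "A \<in> sets circle" for A
    using measurable_compose[OF kernel measurable_measure_prob_algebra[OF that]] .
  have sets: "sets \<kappa>1 = sets circle" "sets \<kappa>2 = sets circle" and "prob_space \<kappa>1" "prob_space \<kappa>2"
    using assms by (auto simp: represents_def space_prob_algebra)
  interpret k1: prob_space \<kappa>1 by fact
  interpret k2: prob_space \<kappa>2 by fact
  show ?thesis
  proof (rule measure_eqI)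
    show "sets \<kappa>1 = sets \<kappa>2" by (simp add: sets)
    fix A assume "A \<in> sets \<kappa>1"
    then have "(\<lambda>b. measure (\<kappa> b) A) -` {measure \<kappa>1 A} \<inter> space M \<in> sets M"
      using measurable_sets[OF meas, of A "{measure \<kappa>1 A}"] sets by auto
    moreover have "True \<in> (\<lambda>b. measure (\<kappa> b) A) -` {measure \<kappa>1 A} \<inter> space M"
      by (simp add: space_M \<kappa>_def)
    ultimately have "False \<in> (\<lambda>b. measure (\<kappa> b) A) -` {measure \<kappa>1 A} \<inter> space M"
      unfolding sets_M by auto
    then show "emeasure \<kappa>1 A = emeasure \<kappa>2 A"
      by (simp add: \<kappa>_def k1.emeasure_eq_measure k2.emeasure_eq_measure)
  qed
qed

section \<open>The Herglotz representation\<close>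

abbreviation cis2pi :: "real \<Rightarrow> complex" where
  "cis2pi x \<equiv> exp (2 * of_real pi * \<i> * of_real x)"

lemma norm_cis2pi [simp]: "norm (cis2pi x) = 1"
proof -
  have "cis2pi x = exp (\<i> * of_real (2 * pi * x))" by (simp add: mult_ac)
  then show ?thesis by (simp only: norm_exp_i_times)
qed

lemma cnj_cis2pi: "cnj (cis2pi x) = 1 / cis2pi x"
  using complex_norm_square[of "cis2pi x"] by (simp add: field_simps)

lemma Cauchy_formula_unit_circle:
  assumes "continuous_on (cball 0 1) f" "f holomorphic_on ball 0 1" "norm z < 1"
  shows "((\<lambda>x. f (cis2pi x) * cis2pi x / (cis2pi x - z)) has_integral f z) {0..1}"
proof -
  have "((\<lambda>u. f u / (u - z)) has_contour_integral (2 * of_real pi * \<i> * f z)) (circlepath 0 1)"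
    using assms by (intro Cauchy_integral_circlepath) auto
  then have "((\<lambda>x. f (cis2pi x) / (cis2pi x - z) * (2 * of_real pi * \<i> * cis2pi x))
      has_integral (2 * of_real pi * \<i> * f z)) {0..1}"
    unfolding has_contour_integral_def
    by (rule has_integral_eq[rotated]) (simp add: vector_derivative_circlepath01, simp add: circlepath)
  then have "((\<lambda>x. f (cis2pi x) / (cis2pi x - z) * (2 * of_real pi * \<i> * cis2pi x) / (2 * of_real pi * \<i>))
      has_integral (2 * of_real pi * \<i> * f z) / (2 * of_real pi * \<i>)) {0..1}"
    by (rule has_integral_divide)
  moreover have "f (cis2pi x) / (cis2pi x - z) * (2 * of_real pi * \<i> * cis2pi x) / (2 * of_real pi * \<i>) =
      f (cis2pi x) * cis2pi x / (cis2pi x - z)" for x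
    by (simp add: divide_simps)
  moreover have "(2 * of_real pi * \<i> * f z) / (2 * of_real pi * \<i>) = f z"
    by simp
  ultimately show ?thesis
    by (simp only:)
qed

lemma mean_value_unit_circle:
  assumes "continuous_on (cball 0 1) f" "f holomorphic_on ball 0 1"
  shows "((\<lambda>x. f (cis2pi x)) has_integral f 0) {0..1}"
  using Cauchy_formula_unit_circle[OF assms, of 0] by simp

text \<open>The weight \<open>1 + 2 Re f\<close> is \<open>1 + f + cnj f\<close>. Integrated against the kernel
\<open>K = w/(w - z) - 1\<close> on the circle, the constant contributes \<open>0\<close>, the function \<open>f\<close> contributes
\<open>f z - f 0 = f z\<close> by Cauchy's formula, and the conjugate contributes \<open>0\<close>, since \<open>cnj K\<close> is the
boundary value of a function that is holomorphic in the disk and vanishes at \<open>0\<close>.\<close>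
lemma Schwarz_formula_unit_circle:
  assumes f: "continuous_on (cball 0 1) f" "f holomorphic_on ball 0 1" "f 0 = 0" and z: "norm z < 1"
  shows "((\<lambda>x. of_real (1 + 2 * Re (f (cis2pi x))) * (z * cnj (cis2pi x) / (1 - z * cnj (cis2pi x))))
           has_integral f z) {0..1}"
proof -
  define K where "K x = cis2pi x / (cis2pi x - z) - 1" for x
  have nz: "cis2pi x - z \<noteq> 0" for x
    using z norm_cis2pi[of x] by (metis eq_iff_diff_eq_0 less_irrefl)
  have K: "z * cnj (cis2pi x) / (1 - z * cnj (cis2pi x)) = K x" for x
    using nz[of x] by (simp add: K_def cnj_cis2pi divide_simps)
  have "((\<lambda>x. 1 * cis2pi x / (cis2pi x - z) - 1) has_integral 1 - 1) {0..1}"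
    using Cauchy_formula_unit_circle[of "\<lambda>_. 1" z] mean_value_unit_circle[of "\<lambda>_. 1"] z
    by (intro has_integral_diff) auto
  then have K1: "(K has_integral 0) {0..1}"
    by (simp add: K_def[abs_def])
  have "((\<lambda>x. f (cis2pi x) * cis2pi x / (cis2pi x - z) - f (cis2pi x)) has_integral f z - f 0) {0..1}"
    by (intro has_integral_diff Cauchy_formula_unit_circle mean_value_unit_circle f z)
  then have Kf: "((\<lambda>x. K x * f (cis2pi x)) has_integral f z) {0..1}"
    using f(3) by (simp add: K_def algebra_simps)
  have nz': "1 - cnj z * w \<noteq> 0" if "norm w \<le> 1" for w
  proof
    assume "1 - cnj z * w = 0"
    then have "norm z * norm w = 1" by (metis complex_mod_cnj eq_iff_diff_eq_0 norm_mult norm_one)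
    moreover have "norm z * norm w \<le> norm z * 1" using that by (intro mult_left_mono) auto
    ultimately show False using z by simp
  qed
  have "((\<lambda>x. (cnj z * cis2pi x / (1 - cnj z * cis2pi x)) * f (cis2pi x))
      has_integral (cnj z * 0 / (1 - cnj z * 0) * f 0)) {0..1}"
    using nz' by (intro mean_value_unit_circle continuous_intros holomorphic_intros f) auto
  moreover have "cnj z * cis2pi x / (1 - cnj z * cis2pi x) = cnj (K x)" for x
    by (simp add: K[symmetric])
  ultimately have "((\<lambda>x. cnj (K x) * f (cis2pi x)) has_integral 0) {0..1}"
    by simp
  from has_integral_linear[OF this bounded_linear_cnj]
  have "((\<lambda>x. K x * cnj (f (cis2pi x))) has_integral 0) {0..1}"
    by (simp add: o_def)
  from has_integral_add[OF K1 has_integral_add[OF Kf this]]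
  have "((\<lambda>x. K x + (K x * f (cis2pi x) + K x * cnj (f (cis2pi x)))) has_integral f z) {0..1}"
    by simp
  moreover have "K x + (K x * f (cis2pi x) + K x * cnj (f (cis2pi x))) =
     of_real (1 + 2 * Re (f (cis2pi x))) * K x" for x
    using complex_add_cnj[of "f (cis2pi x)"] by (simp add: algebra_simps flip: distrib_left) 
  ultimately show ?thesis
    by (simp only: K)
qed

lemma integral_density_unit_interval:
  fixes d :: "real \<Rightarrow> real" and \<phi> :: "real \<Rightarrow> complex"
  assumes d: "continuous_on UNIV d" "\<And>x. 0 \<le> d x" and \<phi>: "continuous_on UNIV \<phi>"
  shows "(\<integral>x. \<phi> x \<partial>density lborel (\<lambda>x. ennreal (indicator {0..1} x * d x))) =
           integral {0..1} (\<lambda>x. of_real (d x) * \<phi> x)"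
proof -
  have [measurable]: "d \<in> borel_measurable borel" "\<phi> \<in> borel_measurable borel"
    using d \<phi> by (auto intro: borel_measurable_continuous_onI)
  have "(\<integral>x. \<phi> x \<partial>density lborel (\<lambda>x. ennreal (indicator {0..1} x * d x))) =
      (\<integral>x. (indicator {0..1} x * d x) *\<^sub>R \<phi> x \<partial>lborel)"
    using d(2) by (intro integral_density) auto
  also have "\<dots> = (LINT x:{0..1}|lborel. of_real (d x) * \<phi> x)"
    unfolding set_lebesgue_integral_def
    by (intro Bochner_Integration.integral_cong) (auto simp: scaleR_conv_of_real indicator_def)
  also have "\<dots> = integral {0..1} (\<lambda>x. of_real (d x) * \<phi> x)"
    by (intro set_borel_integral_eq_integral borel_integrable_atLeastAtMost' continuous_intros
        continuous_on_subset[OF d(1)] continuous_on_subset[OF \<phi>]) auto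
  finally show ?thesis .
qed

lemma real_distribution_density_unit_interval:
  fixes d :: "real \<Rightarrow> real"
  assumes d: "continuous_on UNIV d" "\<And>x. 0 \<le> d x" "(d has_integral 1) {0..1}"
  defines "N \<equiv> density lborel (\<lambda>x. ennreal (indicator {0..1} x * d x))"
  shows "real_distribution N" and "measure N {-1<..1} = 1"
proof -
  have [measurable]: "d \<in> borel_measurable borel"
    using d by (auto intro: borel_measurable_continuous_onI)
  have int: "set_integrable lborel {0..1} d"
    by (intro borel_integrable_atLeastAtMost' continuous_on_subset[OF d(1)]) auto
  have "(\<integral>\<^sup>+x. ennreal (indicator {0..1} x * d x) \<partial>lborel) = ennreal (LINT x:{0..1}|lborel. d x)"
    using int d(2) unfolding set_lebesgue_integral_def set_integrable_def
    by (subst nn_integral_eq_integral) auto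
  also have "(LINT x:{0..1}|lborel. d x) = 1"
    using set_borel_integral_eq_integral(2)[OF int] d(3) by (simp add: integral_unique)
  finally have total: "(\<integral>\<^sup>+x. ennreal (indicator {0..1} x * d x) \<partial>lborel) = 1" by simp
  have "prob_space N"
    by (rule prob_spaceI) (simp add: N_def emeasure_density total)
  then show "real_distribution N"
    by (simp add: real_distribution_def real_distribution_axioms_def N_def)
  have "emeasure N {-1<..1} = (\<integral>\<^sup>+x. ennreal (indicator {0..1} x * d x) * indicator {-1<..1} x \<partial>lborel)"
    by (simp add: N_def emeasure_density)
  also have "\<dots> = (\<integral>\<^sup>+x. ennreal (indicator {0..1} x * d x) \<partial>lborel)"
    by (intro nn_integral_cong) (auto simp: indicator_def)
  finally show "measure N {-1<..1} = 1"
    by (simp add: total measure_def)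
qed

text \<open>On the circle of radius \<open>r < 1\<close> the density \<open>1 + 2 Re F\<close> is nonnegative with mean \<open>1\<close>, and by
the Schwarz formula it represents \<open>z \<mapsto> F (r z)\<close>. As \<open>r\<close> tends to \<open>1\<close> these measures have a weak
limit point, which represents \<open>F\<close>. The limit is taken on the real line, parametrizing the
circle by \<open>[0, 1]\<close>, and then pushed forward by \<open>x \<mapsto> exp (-2\<pi>ix)\<close>; the sign is the one in
\<open>K = z\<zeta>/(1 - z\<zeta>)\<close> with \<open>\<zeta> = 1/w\<close>.\<close>
theorem Herglotz_representation:
  assumes F: "F holomorphic_on ball 0 1" "F 0 = 0" "\<And>z. z \<in> ball 0 1 \<Longrightarrow> Re (F z) \<ge> - 1 / 2"
  shows "\<exists>\<kappa>. represents \<kappa> F"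
proof -
  define r where "r n = 1 - 1 / real (Suc (Suc n))" for n
  have r: "0 < r n" "r n < 1" for n by (auto simp: r_def field_simps)
  have r_lim: "r \<longlonglongrightarrow> 1"
    unfolding r_def using tendsto_diff[OF tendsto_const LIMSEQ_Suc[OF LIMSEQ_Suc[OF lim_1_over_n[where 'a=real]]], of 1]
    by simp
  define G where "G n z = F (of_real (r n) * z)" for n z
  have in_ball: "of_real (r n) * z \<in> ball 0 1" if "norm z \<le> 1" for n and z :: complex
  proof -
    have "norm (of_real (r n) * z) \<le> r n * 1"
      using r[of n] that unfolding norm_mult by (intro mult_mono) auto
    then show ?thesis using r[of n] by simp
  qed
  have contF: "continuous_on (ball 0 1) F"
    using F(1) by (rule holomorphic_on_imp_continuous_on)
  have contG: "continuous_on (cball 0 1) (G n)" for n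
    unfolding G_def using in_ball
    by (intro continuous_on_compose2[OF contF] continuous_intros) auto
  have holG: "G n holomorphic_on ball 0 1" for n
    unfolding G_def using in_ball
    by (intro holomorphic_on_compose_gen[OF _ F(1), unfolded o_def] holomorphic_intros) auto
  have G0: "G n 0 = 0" for n by (simp add: G_def F)
  define d where "d n x = 1 + 2 * Re (G n (cis2pi x))" for n x
  have contd: "continuous_on UNIV (d n)" for n
    unfolding d_def by (intro continuous_intros continuous_on_compose2[OF contG]) auto
  have d_nonneg: "0 \<le> d n x" for n x
    using F(3)[OF in_ball, of "cis2pi x" n] by (simp add: d_def G_def)
  have d_int: "(d n has_integral 1) {0..1}" for n
  proof -
    have "((\<lambda>x. Re (G n (cis2pi x))) has_integral Re (G n 0)) {0..1}"
      using has_integral_linear[OF mean_value_unit_circle[OF contG holG] bounded_linear_Re]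
      by (simp add: o_def)
    then have "((\<lambda>x. 1 + 2 * Re (G n (cis2pi x))) has_integral (1 + 2 * Re (G n 0))) {0..1}"
      using has_integral_const_real[of "1::real" 0 1]
      by (intro has_integral_add has_integral_mult_right) auto
    then show ?thesis by (simp add: d_def[abs_def] G0)
  qed
  define N where "N n = density lborel (\<lambda>x. ennreal (indicator {0..1} x * d n x))" for n
  have N: "real_distribution (N n)" "measure (N n) {-1<..1} = 1" for n
    unfolding N_def using real_distribution_density_unit_interval[OF contd d_nonneg d_int] by auto
  have "tight N"
    unfolding tight_def
  proof (intro conjI allI impI)
    fix \<epsilon> :: real assume "\<epsilon> > 0"
    then show "\<exists>a b. a < b \<and> (\<forall>n. measure (N n) {a<..b} > 1 - \<epsilon>)"
      using N(2) by (intro exI[of _ "-1"] exI[of _ "1"]) simp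
  qed (rule N)
  from tight_imp_convergent_subsubsequence[OF this, of id]
  obtain u L where u: "strict_mono u" and L: "real_distribution L" "weak_conv_m (N \<circ> u) L"
    by (auto simp: strict_mono_def)
  interpret L: real_distribution L by fact
  have [measurable]: "(\<lambda>x. cnj (cis2pi x)) \<in> L \<rightarrow>\<^sub>M circle"
    unfolding circle_def
    by (intro measurable_restrict_space2 borel_measurable_continuous_onI[THEN measurable_cong_sets[OF L.events_eq_borel refl, THEN equalityD2, THEN subsetD]] continuous_intros) auto
  define \<kappa> where "\<kappa> = distr L circle (\<lambda>x. cnj (cis2pi x))"
  have "represents \<kappa> F"
    unfolding represents_def
  proof (intro conjI ballI)
    show "\<kappa> \<in> space (prob_algebra circle)"
      by (simp add: space_prob_algebra \<kappa>_def L.prob_space_distr)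
    fix z :: complex assume "z \<in> ball 0 1"
    then have z: "norm z < 1" by simp
    define \<phi> where "\<phi> x = z * cnj (cis2pi x) / (1 - z * cnj (cis2pi x))" for x
    have cont_k: "continuous_on (sphere 0 1) (\<lambda>\<zeta>. z * \<zeta> / (1 - z * \<zeta>))"
      using z by (intro continuous_intros) (auto dest: one_minus_mult_circle_neq_0)
    have cont_\<phi>: "continuous_on UNIV \<phi>"
      unfolding \<phi>_def using z
      by (intro continuous_intros ballI one_minus_mult_circle_neq_0) auto
    have bd: "norm (\<phi> x) \<le> 1 / (1 - norm z)" for x
      unfolding \<phi>_def norm_divide norm_mult
      using norm_one_minus_mult_circle_ge[of "cnj (cis2pi x)" z] z
      by (intro frac_le) (auto simp: norm_mult)
    have "(\<lambda>n. integral\<^sup>L ((N \<circ> u) n) \<phi>) \<longlonglongrightarrow> integral\<^sup>L L \<phi>"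
    proof (rule weak_conv_imp_integral_bdd_continuous_conv)
      show "real_distribution ((N \<circ> u) n)" for n by (simp add: N)
      show "isCont \<phi> x" for x using cont_\<phi> by (simp add: continuous_on_eq_continuous_at)
    qed (fact L bd)+
    moreover have "integral\<^sup>L ((N \<circ> u) n) \<phi> = G (u n) z" for n
      using Schwarz_formula_unit_circle[OF contG holG G0 z, of "u n"]
      unfolding o_def N_def integral_density_unit_interval[OF contd d_nonneg cont_\<phi>]
      by (intro integral_unique) (simp add: d_def \<phi>_def)
    moreover have "(\<lambda>n. G (u n) z) \<longlonglongrightarrow> F z"
    proof -
      have "(\<lambda>n. of_real (r (u n)) * z) \<longlonglongrightarrow> of_real 1 * z"
        using LIMSEQ_subseq_LIMSEQ[OF r_lim u] by (intro tendsto_intros) (simp add: o_def)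
      then have "(\<lambda>n. F (of_real (r (u n)) * z)) \<longlonglongrightarrow> F (of_real 1 * z)"
        using z in_ball[of z]
        by (intro continuous_on_tendsto_compose[OF contF]) auto
      then show ?thesis by (simp add: G_def)
    qed
    ultimately have "integral\<^sup>L L \<phi> = F z"
      using LIMSEQ_unique by force
    then show "(\<integral>\<zeta>. z * \<zeta> / (1 - z * \<zeta>) \<partial>\<kappa>) = F z"
      unfolding \<kappa>_def \<phi>_def
      by (subst integral_distr) (auto intro!: borel_measurable_circle_continuous[OF cont_k refl])
  qed
  then show ?thesis ..
qed

section \<open>The kernel of a holomorphic self-map of the disk\<close>

text \<open>With \<open>w = u/(1 - u)\<close> one has \<open>u = w/(1 + w)\<close>, so \<open>\<bar>u\<bar> < 1\<close> says that \<open>w\<close> is closer to \<open>0\<close> than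
to \<open>-1\<close>.\<close>
lemma Re_div_one_minus_ge:
  assumes "norm (u::complex) < 1"
  shows "Re (u / (1 - u)) \<ge> - 1 / 2"
proof -
  have nz: "1 - u \<noteq> 0" using assms by auto
  define w where "w = u / (1 - u)"
  have u: "u * (1 + w) = w" using nz by (simp add: w_def field_simps)
  have "norm w ^ 2 = norm u ^ 2 * norm (1 + w) ^ 2"
    by (metis u norm_mult power_mult_distrib)
  also have "\<dots> \<le> 1 * norm (1 + w) ^ 2"
    using assms by (intro mult_right_mono power_le_one) auto
  finally have "0 \<le> 1 + 2 * Re w"
    unfolding cmod_power2 by (simp add: power2_eq_square algebra_simps)
  then show ?thesis by (simp add: w_def)
qed

lemma self_map_represented:
  assumes h: "h holomorphic_on ball 0 1" "h ` ball 0 1 \<subseteq> ball 0 1" "h 0 = 0" and \<xi>: "norm \<xi> = 1"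
  shows "\<exists>!\<kappa>. represents \<kappa> (\<lambda>z. h z * \<xi> / (1 - h z * \<xi>))"
proof (rule ex_ex1I)
  have *: "norm (h z * \<xi>) < 1" if "z \<in> ball 0 1" for z
    using subsetD[OF h(2) imageI[OF that]] \<xi> by (simp add: norm_mult)
  show "\<exists>\<kappa>. represents \<kappa> (\<lambda>z. h z * \<xi> / (1 - h z * \<xi>))"
  proof (rule Herglotz_representation)
    show "(\<lambda>z. h z * \<xi> / (1 - h z * \<xi>)) holomorphic_on ball 0 1"
      using * by (intro holomorphic_intros h(1)) force
  qed (use h(3) Re_div_one_minus_ge * in auto)
qed (rule represents_unique)

definition self_map_kernel :: "(complex \<Rightarrow> complex) \<Rightarrow> complex \<Rightarrow> complex measure" where
  "self_map_kernel h \<xi> = representing_measure (\<lambda>z. h z * \<xi> / (1 - h z * \<xi>))"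

lemma represents_representing_measure: "\<exists>!\<kappa>. represents \<kappa> F \<Longrightarrow> represents (representing_measure F) F"
  unfolding representing_measure_def by (rule theI')

lemma representing_measure_eq: "represents \<kappa> F \<Longrightarrow> representing_measure F = \<kappa>"
  unfolding representing_measure_def by (blast intro: the_equality represents_unique)

text \<open>The real and imaginary parts are treated separately. Their integrals against \<open>K \<eta>\<close> are bounded by
the maximum of the integrand, which gives the integrability needed to put them together again.\<close>
lemma circle_integral_bind:
  fixes f :: "complex \<Rightarrow> complex"
  assumes \<kappa>: "\<kappa> \<in> space (prob_algebra circle)" and K: "K \<in> circle \<rightarrow>\<^sub>M prob_algebra circle"
    and f: "continuous_on (sphere 0 1) f"
  shows "(\<integral>\<zeta>. f \<zeta> \<partial>(\<kappa> \<bind> K)) = (\<integral>\<eta>. (\<integral>\<zeta>. f \<zeta> \<partial>K \<eta>) \<partial>\<kappa>)"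
proof -
  have sets: "sets \<kappa> = sets circle" and pk: "prob_space \<kappa>" using \<kappa> by (auto simp: space_prob_algebra)
  interpret prob_space \<kappa> by fact
  have sp: "space \<kappa> = sphere 0 1" by (rule space_eq_sphere[OF sets])
  have K\<eta>: "sets (K \<eta>) = sets circle" "prob_space (K \<eta>)" if "\<eta> \<in> sphere 0 1" for \<eta>
    using measurable_space[OF K, of \<eta>] that by (auto simp: space_prob_algebra)
  have K': "K \<in> \<kappa> \<rightarrow>\<^sub>M subprob_algebra circle"
    using measurable_prob_algebraD[OF K] sets by (simp cong: measurable_cong_sets)
  have real: "integrable (\<kappa> \<bind> K) g \<and> (\<integral>\<zeta>. g \<zeta> \<partial>(\<kappa> \<bind> K)) = (\<integral>\<eta>. (\<integral>\<zeta>. g \<zeta> \<partial>K \<eta>) \<partial>\<kappa>)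
      \<and> integrable \<kappa> (\<lambda>\<eta>. \<integral>\<zeta>. g \<zeta> \<partial>K \<eta>)"
    if g: "continuous_on (sphere 0 1) g" for g :: "complex \<Rightarrow> real"
  proof -
    obtain B where B: "\<And>\<zeta>. \<zeta> \<in> sphere 0 1 \<Longrightarrow> norm (g \<zeta>) \<le> B"
      using continuous_on_sphere_bounded[OF g] by blast
    have gm: "g \<in> borel_measurable circle" by (rule borel_measurable_circle_continuous[OF g refl])
    have "AE \<eta> in \<kappa>. emeasure (K \<eta>) (space (K \<eta>)) \<le> ennreal 1"
      using K\<eta>(2) by (intro AE_I2) (simp add: sp prob_space.emeasure_space_1)
    note * = integrable_bind[OF gm _ K' finite_measure_axioms this, of B]
        integral_bind[OF gm _ K' finite_measure_axioms this, of B]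
    have "integrable \<kappa> (\<lambda>\<eta>. \<integral>\<zeta>. g \<zeta> \<partial>K \<eta>)"
    proof (rule integrable_const_bound[of _ B])
      show "(\<lambda>\<eta>. \<integral>\<zeta>. g \<zeta> \<partial>K \<eta>) \<in> borel_measurable \<kappa>"
        by (rule measurable_compose[OF K' integral_measurable_subprob_algebra[OF gm]])
      show "AE \<eta> in \<kappa>. norm (\<integral>\<zeta>. g \<zeta> \<partial>K \<eta>) \<le> B"
      proof (rule AE_I2)
        fix \<eta> assume "\<eta> \<in> space \<kappa>"
        then have \<eta>: "\<eta> \<in> sphere 0 1" by (simp add: sp)
        show "norm (\<integral>\<zeta>. g \<zeta> \<partial>K \<eta>) \<le> B"
          using norm_circle_integral_le[OF g K\<eta>(1)[OF \<eta>] prob_space.finite_measure[OF K\<eta>(2)[OF \<eta>]] B]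
            prob_space.prob_space[OF K\<eta>(2)[OF \<eta>]] space_eq_sphere[OF K\<eta>(1)[OF \<eta>]] by simp
      qed
    qed
    then show ?thesis using * B by simp
  qed
  have Re: "continuous_on (sphere 0 1) (\<lambda>\<zeta>. Re (f \<zeta>))" and Im: "continuous_on (sphere 0 1) (\<lambda>\<zeta>. Im (f \<zeta>))"
    using f by (auto intro: continuous_intros)
  have bind: "\<kappa> \<bind> K \<in> space (prob_algebra circle)"
    using prob_space_bind'[OF \<kappa> K] sets_bind'[OF \<kappa> K] by (simp add: space_prob_algebra)
  have intf: "integrable m f" if "m \<in> space (prob_algebra circle)" for m
    using that by (intro integrable_circle_continuous f) (auto simp: space_prob_algebra prob_space.finite_measure)
  have "(\<integral>\<zeta>. f \<zeta> \<partial>(\<kappa> \<bind> K)) = of_real (\<integral>\<zeta>. Re (f \<zeta>) \<partial>(\<kappa> \<bind> K)) + \<i> * of_real (\<integral>\<zeta>. Im (f \<zeta>) \<partial>(\<kappa> \<bind> K))"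
    using integral_Re[OF intf[OF bind]] integral_Im[OF intf[OF bind]] by (simp add: complex_eq_iff)
  also have "\<dots> = of_real (\<integral>\<eta>. (\<integral>\<zeta>. Re (f \<zeta>) \<partial>K \<eta>) \<partial>\<kappa>) + \<i> * of_real (\<integral>\<eta>. (\<integral>\<zeta>. Im (f \<zeta>) \<partial>K \<eta>) \<partial>\<kappa>)"
    using real[OF Re] real[OF Im] by simp
  also have "\<dots> = (\<integral>\<eta>. of_real (\<integral>\<zeta>. Re (f \<zeta>) \<partial>K \<eta>) + \<i> * of_real (\<integral>\<zeta>. Im (f \<zeta>) \<partial>K \<eta>) \<partial>\<kappa>)"
    using real[OF Re] real[OF Im] by (subst Bochner_Integration.integral_add) auto
  also have "\<dots> = (\<integral>\<eta>. (\<integral>\<zeta>. f \<zeta> \<partial>K \<eta>) \<partial>\<kappa>)"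
  proof (rule circle_integral_cong[OF sets])
    fix \<eta> :: complex assume "norm \<eta> = 1"
    then have "integrable (K \<eta>) f" using K\<eta>[of \<eta>] by (intro intf) (simp add: space_prob_algebra)
    then show "of_real (\<integral>\<zeta>. Re (f \<zeta>) \<partial>K \<eta>) + \<i> * of_real (\<integral>\<zeta>. Im (f \<zeta>) \<partial>K \<eta>) = (\<integral>\<zeta>. f \<zeta> \<partial>K \<eta>)"
      by (simp add: complex_eq_iff integral_Re integral_Im)
  qed
  finally show ?thesis .
qed

context
  fixes h :: "complex \<Rightarrow> complex"
  assumes h: "h holomorphic_on ball 0 1" "h ` ball 0 1 \<subseteq> ball 0 1" "h 0 = 0"
begin

lemma represents_self_map_kernel:
  "norm \<xi> = 1 \<Longrightarrow> represents (self_map_kernel h \<xi>) (\<lambda>z. h z * \<xi> / (1 - h z * \<xi>))"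
  unfolding self_map_kernel_def by (rule represents_representing_measure[OF self_map_represented[OF h]])

lemma self_map_kernel_measurable: "self_map_kernel h \<in> circle \<rightarrow>\<^sub>M prob_algebra circle"
proof (rule kernel_measurable)
  show "self_map_kernel h \<xi> \<in> space (prob_algebra circle)" if "\<xi> \<in> space circle" for \<xi>
    using represents_self_map_kernel[of \<xi>] that by (simp add: represents_def)
  fix z :: complex assume z: "z \<in> ball 0 1"
  then have hz: "norm (h z) < 1" using subsetD[OF h(2) imageI[OF z]] by simp
  have "(\<lambda>\<xi>. h z * \<xi> / (1 - h z * \<xi>)) \<in> borel_measurable circle"
    using hz by (intro borel_measurable_circle_continuous[OF _ refl] continuous_intros)
      (auto dest: one_minus_mult_circle_neq_0)
  then show "(\<lambda>\<xi>. \<integral>\<zeta>. z * \<zeta> / (1 - z * \<zeta>) \<partial>self_map_kernel h \<xi>) \<in> borel_measurable circle"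
    by (rule measurable_cong[THEN iffD2, rotated])
      (use represents_self_map_kernel z in \<open>auto simp: represents_def\<close>)
qed

end

text \<open>For fixed \<open>z\<close> the inner integral is \<open>h' z * \<eta> / (1 - h' z * \<eta>)\<close>, which is again the integrand of
the Cauchy transform, now at the point \<open>h' z\<close> of the disk. The outer integral evaluates it to the
function represented at \<open>h (h' z)\<close>, and uniqueness identifies the two measures.\<close>
lemma self_map_kernel_comp:
  assumes h: "h holomorphic_on ball 0 1" "h ` ball 0 1 \<subseteq> ball 0 1" "h 0 = 0"
    and h': "h' holomorphic_on ball 0 1" "h' ` ball 0 1 \<subseteq> ball 0 1" "h' 0 = 0"
    and \<xi>: "norm \<xi> = 1" and h'': "\<And>z. z \<in> ball 0 1 \<Longrightarrow> h'' z = h (h' z)"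
  shows "self_map_kernel h'' \<xi> = self_map_kernel h \<xi> \<bind> self_map_kernel h'"
  unfolding self_map_kernel_def[of h'']
proof (rule representing_measure_eq)
  note m = self_map_kernel_measurable[OF h']
  have \<kappa>: "self_map_kernel h \<xi> \<in> space (prob_algebra circle)"
    using represents_self_map_kernel[OF h \<xi>] by (simp add: represents_def)
  show "represents (self_map_kernel h \<xi> \<bind> self_map_kernel h') (\<lambda>z. h'' z * \<xi> / (1 - h'' z * \<xi>))"
    unfolding represents_def
  proof (intro conjI ballI)
    show "self_map_kernel h \<xi> \<bind> self_map_kernel h' \<in> space (prob_algebra circle)"
      using prob_space_bind'[OF \<kappa> m] sets_bind'[OF \<kappa> m] by (simp add: space_prob_algebra)
    fix z :: complex assume z: "z \<in> ball 0 1"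
    have "continuous_on (sphere 0 1) (\<lambda>\<zeta>. z * \<zeta> / (1 - z * \<zeta>))"
      using z by (intro continuous_intros) (auto dest: one_minus_mult_circle_neq_0)
    then have "(\<integral>\<zeta>. z * \<zeta> / (1 - z * \<zeta>) \<partial>(self_map_kernel h \<xi> \<bind> self_map_kernel h')) =
       (\<integral>\<eta>. (\<integral>\<zeta>. z * \<zeta> / (1 - z * \<zeta>) \<partial>self_map_kernel h' \<eta>) \<partial>self_map_kernel h \<xi>)"
      by (rule circle_integral_bind[OF \<kappa> m])
    also have "\<dots> = (\<integral>\<eta>. h' z * \<eta> / (1 - h' z * \<eta>) \<partial>self_map_kernel h \<xi>)"
      using \<kappa> represents_self_map_kernel[OF h'] z
      by (intro circle_integral_cong) (auto simp: space_prob_algebra represents_def)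
    also have "\<dots> = h (h' z) * \<xi> / (1 - h (h' z) * \<xi>)"
      using represents_self_map_kernel[OF h \<xi>] subsetD[OF h'(2) imageI[OF z]] by (simp add: represents_def)
    finally show "(\<integral>\<zeta>. z * \<zeta> / (1 - z * \<zeta>) \<partial>(self_map_kernel h \<xi> \<bind> self_map_kernel h')) =
       h'' z * \<xi> / (1 - h'' z * \<xi>)"
      using h''[OF z] by simp
  qed
qed

lemma self_map_kernel_id:
  assumes \<xi>: "norm \<xi> = 1" and h: "\<And>z. z \<in> ball 0 1 \<Longrightarrow> h z = z"
  shows "self_map_kernel h \<xi> = return circle \<xi>"
  unfolding self_map_kernel_def
proof (rule representing_measure_eq)
  show "represents (return circle \<xi>) (\<lambda>z. h z * \<xi> / (1 - h z * \<xi>))"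
    unfolding represents_def
  proof (intro conjI ballI)
    show "return circle \<xi> \<in> space (prob_algebra circle)"
      using \<xi> by (simp add: space_prob_algebra prob_space_return)
    fix z :: complex assume z: "z \<in> ball 0 1"
    have "(\<lambda>\<zeta>. z * \<zeta> / (1 - z * \<zeta>)) \<in> borel_measurable circle"
      using z by (intro borel_measurable_circle_continuous[OF _ refl] continuous_intros)
        (auto dest: one_minus_mult_circle_neq_0)
    then show "(\<integral>\<zeta>. z * \<zeta> / (1 - z * \<zeta>) \<partial>return circle \<xi>) = h z * \<xi> / (1 - h z * \<xi>)"
      using \<xi> h[OF z] by (subst integral_return) auto
  qed
qed

section \<open>Integrals against the driving measures\<close>

locale loewner_driver =
  fixes \<mu> :: "real \<Rightarrow> complex measure" and C :: real
  assumes circle_measure: "0 \<le> t \<Longrightarrow> \<mu> t \<in> circle_measures"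
    and finite_discontinuities: "finite {t \<in> {0..a}. \<not> weakly_continuous_at \<mu> t}"
    and mass_le: "0 \<le> t \<Longrightarrow> measure (\<mu> t) (sphere 0 1) \<le> C"
begin

lemma mass_nonneg: "0 \<le> C"
  using mass_le[of 0] measure_nonneg[of "\<mu> 0" "sphere 0 1"] by linarith

lemma driver_sets: "0 \<le> t \<Longrightarrow> sets (\<mu> t) = sets circle"
  and driver_finite: "0 \<le> t \<Longrightarrow> finite_measure (\<mu> t)"
  using circle_measure[of t] by (auto simp: circle_measures_def)

lemma driver_integrable:
  fixes \<phi> :: "complex \<Rightarrow> 'b :: {banach, second_countable_topology}"
  shows "0 \<le> t \<Longrightarrow> continuous_on (sphere 0 1) \<phi> \<Longrightarrow> integrable (\<mu> t) \<phi>"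
  by (intro integrable_circle_continuous driver_sets driver_finite)

lemma norm_driver_integral_le:
  fixes \<phi> :: "complex \<Rightarrow> 'b :: {banach, second_countable_topology}"
  assumes "0 \<le> t" "continuous_on (sphere 0 1) \<phi>" "\<And>\<zeta>. norm \<zeta> = 1 \<Longrightarrow> norm (\<phi> \<zeta>) \<le> B"
  shows "norm (\<integral>\<zeta>. \<phi> \<zeta> \<partial>\<mu> t) \<le> B * C"
proof -
  have "0 \<le> B" using assms(3)[of 1] norm_ge_zero[of "\<phi> 1"] by (simp del: norm_ge_zero)
  have "norm (\<integral>\<zeta>. \<phi> \<zeta> \<partial>\<mu> t) \<le> B * measure (\<mu> t) (sphere 0 1)"
    using assms by (intro norm_circle_integral_le driver_sets driver_finite) auto
  also have "\<dots> \<le> B * C"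
    using \<open>0 \<le> B\<close> mass_le[OF assms(1)] by (intro mult_left_mono)
  finally show ?thesis .
qed

lemma weakly_continuous_complex:
  fixes \<phi> :: "complex \<Rightarrow> complex"
  assumes "weakly_continuous_at \<mu> t" "0 \<le> t" "continuous_on (sphere 0 1) \<phi>"
  shows "((\<lambda>s. \<integral>\<zeta>. \<phi> \<zeta> \<partial>\<mu> s) \<longlongrightarrow> (\<integral>\<zeta>. \<phi> \<zeta> \<partial>\<mu> t)) (at t within {0..})"
proof -
  have *: "((\<lambda>s. \<integral>\<zeta>. Re (\<phi> \<zeta>) \<partial>\<mu> s) \<longlongrightarrow> (\<integral>\<zeta>. Re (\<phi> \<zeta>) \<partial>\<mu> t)) (at t within {0..})"
    "((\<lambda>s. \<integral>\<zeta>. Im (\<phi> \<zeta>) \<partial>\<mu> s) \<longlongrightarrow> (\<integral>\<zeta>. Im (\<phi> \<zeta>) \<partial>\<mu> t)) (at t within {0..})"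
    using assms by (auto simp: weakly_continuous_at_def weak_tendsto_def intro!: continuous_intros)
  have ev: "\<forall>\<^sub>F s in at t within {0..}. 0 \<le> s"
    by (simp add: eventually_at_filter)
  have "((\<lambda>s. Re (\<integral>\<zeta>. \<phi> \<zeta> \<partial>\<mu> s)) \<longlongrightarrow> Re (\<integral>\<zeta>. \<phi> \<zeta> \<partial>\<mu> t)) (at t within {0..})"
    using *(1) assms
    by (subst integral_Re[symmetric], simp add: driver_integrable)
      (rule Lim_transform_eventually[rotated], rule eventually_mono[OF ev], auto simp: integral_Re driver_integrable)
  moreover have "((\<lambda>s. Im (\<integral>\<zeta>. \<phi> \<zeta> \<partial>\<mu> s)) \<longlongrightarrow> Im (\<integral>\<zeta>. \<phi> \<zeta> \<partial>\<mu> t)) (at t within {0..})"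
    using *(2) assms
    by (subst integral_Im[symmetric], simp add: driver_integrable)
      (rule Lim_transform_eventually[rotated], rule eventually_mono[OF ev], auto simp: integral_Im driver_integrable)
  ultimately show ?thesis by (simp add: tendsto_complex_iff)
qed

text \<open>All integrands that occur depend on time through one or two continuous curves, so they are
jointly continuous in time and in the point of the circle. By compactness such an integrand
moves uniformly in \<open>\<zeta>\<close>, and its integral against \<open>\<mu> s\<close> is therefore continuous in \<open>s\<close> wherever \<open>\<mu>\<close> is weakly continuous.\<close>
context
  fixes a b :: real and F :: "real \<Rightarrow> complex \<Rightarrow> complex"
  assumes a: "0 \<le> a" and F: "continuous_on ({a..b} \<times> sphere 0 1) (\<lambda>(s, \<zeta>). F s \<zeta>)"
begin

lemma param_continuous_on_sphere:
  assumes "s \<in> {a..b}"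
  shows "continuous_on (sphere 0 1) (F s)"
proof -
  have "continuous_on (sphere 0 1) (\<lambda>\<zeta>. (s, \<zeta>))" by (intro continuous_intros)
  moreover have "(\<lambda>\<zeta>. (s, \<zeta>)) ` sphere 0 1 \<subseteq> {a..b} \<times> sphere 0 1" using assms by auto
  ultimately show ?thesis using continuous_on_compose2[OF F] by fastforce
qed

lemma param_integral_continuous:
  assumes s0: "s0 \<in> {a..b}" and wc: "weakly_continuous_at \<mu> s0"
  shows "continuous (at s0 within {a..b}) (\<lambda>s. \<integral>\<zeta>. F s \<zeta> \<partial>\<mu> s)"
proof -
  have unif: "uniformly_continuous_on ({a..b} \<times> sphere 0 1) (\<lambda>(s, \<zeta>). F s \<zeta>)"
    by (intro compact_uniformly_continuous F compact_Times compact_Icc compact_sphere)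
  have diff: "((\<lambda>s. (\<integral>\<zeta>. F s \<zeta> \<partial>\<mu> s) - (\<integral>\<zeta>. F s0 \<zeta> \<partial>\<mu> s)) \<longlongrightarrow> 0) (at s0 within {a..b})"
  proof (rule tendstoI)
    fix e :: real assume e: "e > 0"
    define e' where "e' = e / (C + 1)"
    have e': "e' > 0" "e' * C < e" using e mass_nonneg by (auto simp: e'_def field_simps)
    obtain d where d: "d > 0"
      "\<And>x y. x \<in> {a..b} \<times> sphere 0 1 \<Longrightarrow> y \<in> {a..b} \<times> sphere 0 1 \<Longrightarrow> dist y x < d \<Longrightarrow>
         dist (case y of (s, \<zeta>) \<Rightarrow> F s \<zeta>) (case x of (s, \<zeta>) \<Rightarrow> F s \<zeta>) < e'"
      using unif[unfolded uniformly_continuous_on_def, rule_format, OF e'(1)] by blast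
    have "\<forall>\<^sub>F s in at s0 within {a..b}. s \<in> {a..b} \<and> dist s s0 < d"
      using d(1) unfolding eventually_at by blast
    then show "\<forall>\<^sub>F s in at s0 within {a..b}. dist ((\<integral>\<zeta>. F s \<zeta> \<partial>\<mu> s) - (\<integral>\<zeta>. F s0 \<zeta> \<partial>\<mu> s)) 0 < e"
    proof eventually_elim
      case (elim s)
      then have s: "s \<in> {a..b}" "0 \<le> s" using a by auto
      have "(\<integral>\<zeta>. F s \<zeta> \<partial>\<mu> s) - (\<integral>\<zeta>. F s0 \<zeta> \<partial>\<mu> s) = (\<integral>\<zeta>. F s \<zeta> - F s0 \<zeta> \<partial>\<mu> s)"
        using s s0 by (intro Bochner_Integration.integral_diff[symmetric] driver_integrable param_continuous_on_sphere)
      also have "norm \<dots> \<le> e' * C"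
      proof (rule norm_driver_integral_le[OF s(2)])
        show "continuous_on (sphere 0 1) (\<lambda>\<zeta>. F s \<zeta> - F s0 \<zeta>)"
          using s s0 by (intro continuous_intros param_continuous_on_sphere)
        show "norm (F s \<zeta> - F s0 \<zeta>) \<le> e'" if "norm \<zeta> = 1" for \<zeta>
          using d(2)[of "(s0, \<zeta>)" "(s, \<zeta>)"] that s s0 elim by (auto simp: dist_Pair_Pair dist_norm)
      qed
      finally show ?case using e' by simp
    qed
  qed
  have "((\<lambda>s. \<integral>\<zeta>. F s0 \<zeta> \<partial>\<mu> s) \<longlongrightarrow> (\<integral>\<zeta>. F s0 \<zeta> \<partial>\<mu> s0)) (at s0 within {a..b})"
    using s0 a by (intro tendsto_within_subset[OF weakly_continuous_complex[OF wc]] param_continuous_on_sphere) auto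
  from tendsto_add[OF diff this] show ?thesis
    by (simp add: continuous_within)
qed

text \<open>The integral is bounded, and continuous off a finite set.\<close>
lemma param_integral_integrable: "(\<lambda>s. \<integral>\<zeta>. F s \<zeta> \<partial>\<mu> s) integrable_on {a..b}"
proof -
  define X where "X = {t \<in> {0..b}. \<not> weakly_continuous_at \<mu> t}"
  have X: "finite X" unfolding X_def by (rule finite_discontinuities)
  have "bounded ((\<lambda>(s, \<zeta>). F s \<zeta>) ` ({a..b} \<times> sphere 0 1))"
    by (intro compact_imp_bounded compact_continuous_image F compact_Times compact_Icc compact_sphere)
  then obtain B where B: "\<And>s \<zeta>. s \<in> {a..b} \<Longrightarrow> norm \<zeta> = 1 \<Longrightarrow> norm (F s \<zeta>) \<le> B"
    unfolding bounded_iff by fastforce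
  have meas: "{a..b} - X \<in> sets lebesgue"
    using X by (intro sets.Diff) (auto intro: negligible_imp_sets)
  have "(\<lambda>s. \<integral>\<zeta>. F s \<zeta> \<partial>\<mu> s) integrable_on ({a..b} - X)"
  proof (rule measurable_bounded_by_integrable_imp_integrable[OF _ _ _ meas])
    have "continuous_on ({a..b} - X) (\<lambda>s. \<integral>\<zeta>. F s \<zeta> \<partial>\<mu> s)"
      unfolding continuous_on_eq_continuous_within using a
      by (auto simp: X_def intro!: continuous_within_subset[OF param_integral_continuous])
    then show "(\<lambda>s. \<integral>\<zeta>. F s \<zeta> \<partial>\<mu> s) \<in> borel_measurable (lebesgue_on ({a..b} - X))"
      using meas by (rule continuous_imp_measurable_on_sets_lebesgue)
    show "norm (\<integral>\<zeta>. F s \<zeta> \<partial>\<mu> s) \<le> B * C" if "s \<in> {a..b} - X" for s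
      using that a by (intro norm_driver_integral_le param_continuous_on_sphere B) auto
    show "(\<lambda>s. B * C) integrable_on ({a..b} - X)"
      by (rule integrable_spike_set[OF integrable_const_ivl[of _ a b]])
        (auto intro: negligible_subset[OF negligible_finite[OF X]])
  qed
  then show ?thesis
    by (rule integrable_spike_set) (auto intro: negligible_subset[OF negligible_finite[OF X]])
qed

lemma param_integral_derivative:
  assumes "s \<in> {a..b}" "weakly_continuous_at \<mu> s"
  shows "((\<lambda>u. integral {a..u} (\<lambda>s. \<integral>\<zeta>. F s \<zeta> \<partial>\<mu> s)) has_vector_derivative (\<integral>\<zeta>. F s \<zeta> \<partial>\<mu> s)) (at s within {a..b})"
  using integral_has_vector_derivative_continuous_at[OF param_integral_integrable, of s "{}"]
    param_integral_continuous[OF assms] assms by simp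

end

end

section \<open>The Loewner vector field\<close>

definition herglotz_transform :: "complex measure \<Rightarrow> complex \<Rightarrow> complex" where
  "herglotz_transform m z = (\<integral>\<zeta>. (cnj \<zeta> + z) / (cnj \<zeta> - z) \<partial>m)"

text \<open>This is the divided difference of the Loewner field, see \<open>loewner_field_diff\<close>. It is an
integral formula, so that it makes sense and is continuous on the diagonal as well.\<close>
definition loewner_quotient :: "complex measure \<Rightarrow> complex \<Rightarrow> complex \<Rightarrow> complex" where
  "loewner_quotient m z w = (\<integral>\<zeta>. 2 / ((1 - z * \<zeta>) * (1 - w * \<zeta>)) - 1 \<partial>m)"

lemma loewner_field_eq: "loewner_field m z = z * herglotz_transform m z"
  by (simp add: loewner_field_def herglotz_transform_def)

lemma cnj_circle_minus_neq_0: "norm (z::complex) < 1 \<Longrightarrow> norm \<zeta> = 1 \<Longrightarrow> cnj \<zeta> - z \<noteq> 0"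
  by (metis complex_mod_cnj eq_iff_diff_eq_0 less_irrefl)

lemma herglotz_kernel_eq:
  assumes "norm z < 1" "norm \<zeta> = 1"
  shows "(cnj \<zeta> + z) / (cnj \<zeta> - z) = 2 / (1 - z * \<zeta>) - 1"
proof -
  have "cnj \<zeta> * \<zeta> = 1"
    using complex_norm_square[of \<zeta>] assms by (simp add: mult.commute)
  then have eq: "cnj \<zeta> - z = cnj \<zeta> * (1 - z * \<zeta>)" "cnj \<zeta> + z = cnj \<zeta> * (1 + z * \<zeta>)"
    by (simp_all add: algebra_simps)
  have "cnj \<zeta> \<noteq> 0" using assms by auto
  then show ?thesis
    unfolding eq using one_minus_mult_circle_neq_0[OF assms]
    by (simp add: divide_simps)
qed

lemma Re_herglotz_kernel_nonneg:
  assumes "norm z < 1" "norm \<zeta> = 1"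
  shows "0 \<le> Re ((cnj \<zeta> + z) / (cnj \<zeta> - z))"
proof -
  have "norm (z * \<zeta>) < 1" using assms by (simp add: norm_mult)
  then have "Re (z * \<zeta> / (1 - z * \<zeta>)) \<ge> - 1 / 2" by (rule Re_div_one_minus_ge)
  moreover have "2 / (1 - z * \<zeta>) - 1 = 1 + of_real 2 * (z * \<zeta> / (1 - z * \<zeta>))"
    using one_minus_mult_circle_neq_0[OF assms] by (simp add: field_simps)
  then have "Re (2 / (1 - z * \<zeta>) - 1) = 1 + 2 * Re (z * \<zeta> / (1 - z * \<zeta>))"
    by (simp only: plus_complex.sel one_complex.sel times_complex.sel Re_complex_of_real Im_complex_of_real)
  ultimately show ?thesis
    unfolding herglotz_kernel_eq[OF assms] by linarith
qed

lemma norm_inverse_one_minus_le: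
  assumes "norm z \<le> \<rho>" "\<rho> < 1" "norm (\<zeta>::complex) = 1"
  shows "norm (1 / (1 - z * \<zeta>)) \<le> 1 / (1 - \<rho>)"
  using norm_one_minus_mult_circle_ge[OF assms(3), of z] assms
  by (simp add: norm_divide frac_le)

context loewner_driver
begin

lemma herglotz_transform_diff_le:
  assumes t: "0 \<le> t" and \<rho>: "\<rho> < 1" and z: "norm z \<le> \<rho>" and w: "norm w \<le> \<rho>"
  shows "norm (herglotz_transform (\<mu> t) z - herglotz_transform (\<mu> t) w) \<le> 2 * C / (1 - \<rho>)\<^sup>2 * norm (z - w)"
proof -
  have z1: "norm z < 1" and w1: "norm w < 1" using assms by auto
  have cont: "continuous_on (sphere 0 1) (\<lambda>\<zeta>. (cnj \<zeta> + u) / (cnj \<zeta> - u))" if "norm u < 1" for u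
    using cnj_circle_minus_neq_0[OF that] by (intro continuous_intros) auto
  have "herglotz_transform (\<mu> t) z - herglotz_transform (\<mu> t) w =
     (\<integral>\<zeta>. (cnj \<zeta> + z) / (cnj \<zeta> - z) - (cnj \<zeta> + w) / (cnj \<zeta> - w) \<partial>\<mu> t)"
    unfolding herglotz_transform_def
    by (intro Bochner_Integration.integral_diff[symmetric] driver_integrable t cont z1 w1)
  also have "norm \<dots> \<le> (2 / (1 - \<rho>)\<^sup>2 * norm (z - w)) * C"
  proof (intro norm_driver_integral_le t continuous_on_diff cont z1 w1)
    fix \<zeta> :: complex assume \<zeta>: "norm \<zeta> = 1"
    have "(cnj \<zeta> + z) / (cnj \<zeta> - z) - (cnj \<zeta> + w) / (cnj \<zeta> - w) =
       2 * \<zeta> * (z - w) * ((1 / (1 - z * \<zeta>)) * (1 / (1 - w * \<zeta>)))"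
      unfolding herglotz_kernel_eq[OF z1 \<zeta>] herglotz_kernel_eq[OF w1 \<zeta>]
      using one_minus_mult_circle_neq_0[OF z1 \<zeta>] one_minus_mult_circle_neq_0[OF w1 \<zeta>]
      by (simp add: divide_simps) (simp add: algebra_simps)
    also have "norm \<dots> = 2 * norm (z - w) * (norm (1 / (1 - z * \<zeta>)) * norm (1 / (1 - w * \<zeta>)))"
      by (simp only: norm_mult \<zeta>) simp
    also have "\<dots> \<le> 2 * norm (z - w) * (1 / (1 - \<rho>) * (1 / (1 - \<rho>)))"
      using \<rho> by (intro mult_left_mono mult_mono norm_inverse_one_minus_le z w \<zeta>) auto
    also have "\<dots> = 2 / (1 - \<rho>)\<^sup>2 * norm (z - w)"
      by (simp add: power2_eq_square)
    finally show "norm ((cnj \<zeta> + z) / (cnj \<zeta> - z) - (cnj \<zeta> + w) / (cnj \<zeta> - w)) \<le> 2 / (1 - \<rho>)\<^sup>2 * norm (z - w)" .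
  qed
  finally show ?thesis by (simp add: mult_ac)
qed

lemma norm_herglotz_transform_le:
  assumes t: "0 \<le> t" and \<rho>: "\<rho> < 1" and z: "norm z \<le> \<rho>"
  shows "norm (herglotz_transform (\<mu> t) z) \<le> (2 / (1 - \<rho>) + 1) * C"
  unfolding herglotz_transform_def
proof (intro norm_driver_integral_le t)
  have z1: "norm z < 1" using assms by auto
  then show "continuous_on (sphere 0 1) (\<lambda>\<zeta>. (cnj \<zeta> + z) / (cnj \<zeta> - z))"
    using cnj_circle_minus_neq_0 by (intro continuous_intros) auto
  fix \<zeta> :: complex assume \<zeta>: "norm \<zeta> = 1"
  have "norm ((cnj \<zeta> + z) / (cnj \<zeta> - z)) = norm (2 * (1 / (1 - z * \<zeta>)) - 1)"
    unfolding herglotz_kernel_eq[OF z1 \<zeta>] by simp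
  also have "\<dots> \<le> norm (2 * (1 / (1 - z * \<zeta>))) + 1"
    using norm_triangle_ineq4[of "2 * (1 / (1 - z * \<zeta>))" 1] by simp
  also have "\<dots> \<le> 2 / (1 - \<rho>) + 1"
    using mult_left_mono[OF norm_inverse_one_minus_le[OF z \<rho> \<zeta>], of 2] by (simp add: norm_divide)
  finally show "norm ((cnj \<zeta> + z) / (cnj \<zeta> - z)) \<le> 2 / (1 - \<rho>) + 1" .
qed

lemma Re_herglotz_transform_nonneg:
  assumes t: "0 \<le> t" and z: "norm z < 1"
  shows "0 \<le> Re (herglotz_transform (\<mu> t) z)"
proof -
  have "integrable (\<mu> t) (\<lambda>\<zeta>. (cnj \<zeta> + z) / (cnj \<zeta> - z))"
    using cnj_circle_minus_neq_0[OF z] by (intro driver_integrable t continuous_intros) auto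
  then have "Re (herglotz_transform (\<mu> t) z) = (\<integral>\<zeta>. Re ((cnj \<zeta> + z) / (cnj \<zeta> - z)) \<partial>\<mu> t)"
    unfolding herglotz_transform_def by (rule integral_Re[symmetric])
  also have "\<dots> \<ge> 0"
    using space_eq_sphere[OF driver_sets[OF t]] Re_herglotz_kernel_nonneg[OF z]
    by (intro integral_nonneg_AE AE_I2) auto
  finally show ?thesis .
qed

lemma continuous_on_quotient_kernel:
  fixes z w :: complex
  assumes "norm z < 1" "norm w < 1"
  shows "continuous_on (sphere 0 1) (\<lambda>\<zeta>. 2 / ((1 - z * \<zeta>) * (1 - w * \<zeta>)) - 1)"
  using assms by (intro continuous_intros) (auto dest: one_minus_mult_circle_neq_0)

lemma loewner_field_diff:
  assumes t: "0 \<le> t" and z: "norm z < 1" and w: "norm w < 1"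
  shows "loewner_field (\<mu> t) z - loewner_field (\<mu> t) w = (z - w) * loewner_quotient (\<mu> t) z w"
proof -
  have cont: "continuous_on (sphere 0 1) (\<lambda>\<zeta>. (cnj \<zeta> + u) / (cnj \<zeta> - u))" if "norm u < 1" for u
    using cnj_circle_minus_neq_0[OF that] by (intro continuous_intros) auto
  have "loewner_field (\<mu> t) z - loewner_field (\<mu> t) w =
     (\<integral>\<zeta>. z * ((cnj \<zeta> + z) / (cnj \<zeta> - z)) - w * ((cnj \<zeta> + w) / (cnj \<zeta> - w)) \<partial>\<mu> t)"
    unfolding loewner_field_def
    by (simp only: integral_mult_right_zero[symmetric])
      (intro Bochner_Integration.integral_diff[symmetric] integrable_mult_right driver_integrable t cont z w)
  also have "\<dots> = (\<integral>\<zeta>. (z - w) * (2 / ((1 - z * \<zeta>) * (1 - w * \<zeta>)) - 1) \<partial>\<mu> t)"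
  proof (rule circle_integral_cong[OF driver_sets[OF t]])
    fix \<zeta> :: complex assume \<zeta>: "norm \<zeta> = 1"
    show "z * ((cnj \<zeta> + z) / (cnj \<zeta> - z)) - w * ((cnj \<zeta> + w) / (cnj \<zeta> - w)) =
        (z - w) * (2 / ((1 - z * \<zeta>) * (1 - w * \<zeta>)) - 1)"
      unfolding herglotz_kernel_eq[OF z \<zeta>] herglotz_kernel_eq[OF w \<zeta>]
      using one_minus_mult_circle_neq_0[OF z \<zeta>] one_minus_mult_circle_neq_0[OF w \<zeta>]
      by (simp add: divide_simps) (simp add: algebra_simps)
  qed
  also have "\<dots> = (z - w) * loewner_quotient (\<mu> t) z w"
    by (simp add: loewner_quotient_def)
  finally show ?thesis .
qed

lemma norm_loewner_quotient_le:
  assumes t: "0 \<le> t" and \<rho>: "\<rho> < 1" and z: "norm z \<le> \<rho>" and w: "norm w \<le> \<rho>"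
  shows "norm (loewner_quotient (\<mu> t) z w) \<le> (2 / (1 - \<rho>)\<^sup>2 + 1) * C"
  unfolding loewner_quotient_def
proof (intro norm_driver_integral_le t continuous_on_quotient_kernel)
  show "norm z < 1" "norm w < 1" using assms by auto
  fix \<zeta> :: complex assume \<zeta>: "norm \<zeta> = 1"
  have "norm (2 / ((1 - z * \<zeta>) * (1 - w * \<zeta>)) - 1) \<le> norm (2 * ((1 / (1 - z * \<zeta>)) * (1 / (1 - w * \<zeta>)))) + 1"
    using norm_triangle_ineq4[of "2 / ((1 - z * \<zeta>) * (1 - w * \<zeta>))" 1] by simp
  also have "norm (2 * ((1 / (1 - z * \<zeta>)) * (1 / (1 - w * \<zeta>)))) =
      2 * (norm (1 / (1 - z * \<zeta>)) * norm (1 / (1 - w * \<zeta>)))"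
    by (simp only: norm_mult) simp
  also have "\<dots> \<le> 2 * (1 / (1 - \<rho>) * (1 / (1 - \<rho>)))"
    using \<rho> by (intro mult_left_mono mult_mono norm_inverse_one_minus_le z w \<zeta>) auto
  also have "\<dots> = 2 / (1 - \<rho>)\<^sup>2" by (simp add: power2_eq_square)
  finally show "norm (2 / ((1 - z * \<zeta>) * (1 - w * \<zeta>)) - 1) \<le> 2 / (1 - \<rho>)\<^sup>2 + 1" by simp
qed

lemma loewner_quotient_diff_le:
  assumes t: "0 \<le> t" and \<rho>: "\<rho> < 1" and z: "norm z \<le> \<rho>" and w: "norm w \<le> \<rho>"
  shows "norm (loewner_quotient (\<mu> t) w z - loewner_quotient (\<mu> t) z z) \<le> 2 * C / (1 - \<rho>) ^ 3 * norm (w - z)"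
proof -
  have z1: "norm z < 1" and w1: "norm w < 1" using assms by auto
  have "loewner_quotient (\<mu> t) w z - loewner_quotient (\<mu> t) z z =
     (\<integral>\<zeta>. (2 / ((1 - w * \<zeta>) * (1 - z * \<zeta>)) - 1) - (2 / ((1 - z * \<zeta>) * (1 - z * \<zeta>)) - 1) \<partial>\<mu> t)"
    unfolding loewner_quotient_def
    by (intro Bochner_Integration.integral_diff[symmetric] driver_integrable t continuous_on_quotient_kernel z1 w1)
  also have "norm \<dots> \<le> (2 / (1 - \<rho>) ^ 3 * norm (w - z)) * C"
  proof (rule norm_driver_integral_le[OF t continuous_on_diff])
    show "continuous_on (sphere 0 1) (\<lambda>\<zeta>. 2 / ((1 - w * \<zeta>) * (1 - z * \<zeta>)) - 1)"
      "continuous_on (sphere 0 1) (\<lambda>\<zeta>. 2 / ((1 - z * \<zeta>) * (1 - z * \<zeta>)) - 1)"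
      by (intro continuous_on_quotient_kernel z1 w1)+
    fix \<zeta> :: complex assume \<zeta>: "norm \<zeta> = 1"
    have "(2 / ((1 - w * \<zeta>) * (1 - z * \<zeta>)) - 1) - (2 / ((1 - z * \<zeta>) * (1 - z * \<zeta>)) - 1) =
       2 * \<zeta> * (w - z) * ((1 / (1 - w * \<zeta>)) * ((1 / (1 - z * \<zeta>)) * (1 / (1 - z * \<zeta>))))"
      using one_minus_mult_circle_neq_0[OF z1 \<zeta>] one_minus_mult_circle_neq_0[OF w1 \<zeta>]
      by (simp add: divide_simps) (simp add: algebra_simps)
    also have "norm \<dots> = 2 * norm (w - z) *
        (norm (1 / (1 - w * \<zeta>)) * (norm (1 / (1 - z * \<zeta>)) * norm (1 / (1 - z * \<zeta>))))"
      by (simp only: norm_mult \<zeta>) simp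
    also have "\<dots> \<le> 2 * norm (w - z) * (1 / (1 - \<rho>) * (1 / (1 - \<rho>) * (1 / (1 - \<rho>))))"
      using \<rho> by (intro mult_left_mono mult_mono norm_inverse_one_minus_le z w \<zeta>) auto
    also have "\<dots> = 2 / (1 - \<rho>) ^ 3 * norm (w - z)"
      by (simp add: power3_eq_cube)
    finally show "norm ((2 / ((1 - w * \<zeta>) * (1 - z * \<zeta>)) - 1) - (2 / ((1 - z * \<zeta>) * (1 - z * \<zeta>)) - 1))
      \<le> 2 / (1 - \<rho>) ^ 3 * norm (w - z)" .
  qed
  finally show ?thesis by (simp add: mult_ac)
qed

end

section \<open>Comparison of solutions\<close>

text \<open>A solution on a compact interval. The derivative is one-sided at both end points, so that
the notion passes to subintervals and depends on nothing outside the interval.\<close>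
definition loewner_curve :: "(real \<Rightarrow> complex measure) \<Rightarrow> real \<Rightarrow> real \<Rightarrow> (real \<Rightarrow> complex) \<Rightarrow> bool" where
  "loewner_curve \<mu> a b \<gamma> \<longleftrightarrow>
     continuous_on {a..b} \<gamma> \<and> (\<forall>s\<in>{a..b}. norm (\<gamma> s) < 1) \<and>
     (\<forall>s\<in>{a..b}. weakly_continuous_at \<mu> s \<longrightarrow>
        (\<gamma> has_vector_derivative loewner_field (\<mu> s) (\<gamma> s)) (at s within {a..b}))"

lemma loewner_curve_subinterval:
  "loewner_curve \<mu> a b \<gamma> \<Longrightarrow> a \<le> a' \<Longrightarrow> b' \<le> b \<Longrightarrow> loewner_curve \<mu> a' b' \<gamma>"
  unfolding loewner_curve_def
  by (auto elim: continuous_on_subset intro!: has_vector_derivative_within_subset[of \<gamma> _ _ "{a..b}" "{a'..b'}"])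

lemma loewner_curve_cong:
  assumes "loewner_curve \<mu> a b \<gamma>" "\<And>s. s \<in> {a..b} \<Longrightarrow> \<gamma>' s = \<gamma> s"
  shows "loewner_curve \<mu> a b \<gamma>'"
  using assms unfolding loewner_curve_def
  by (auto intro: has_vector_derivative_transform continuous_on_cong[THEN iffD1, rotated -1])

lemma norm_exp_minus_diff_le:
  fixes A B :: complex
  assumes "0 \<le> Re A" "0 \<le> Re B"
  shows "norm (exp (- A) - exp (- B)) \<le> norm (A - B)"
proof -
  have "norm (exp (- A) - exp (- B)) \<le> 1 * norm (A - B)"
  proof (rule field_differentiable_bound[where S = "{z. 0 \<le> Re z}" and f' = "\<lambda>z. - exp (- z)"])
    show "convex {z. 0 \<le> Re z}" by (rule convex_halfspace_Re_ge)
    show "((\<lambda>z. exp (- z)) has_field_derivative - exp (- z)) (at z within {z. 0 \<le> Re z})" for z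
      by (auto intro!: derivative_eq_intros)
  qed (use assms in auto)
  then show ?thesis by simp
qed

lemma vector_derivative_exp_minus:
  fixes J :: "real \<Rightarrow> complex"
  assumes "(J has_vector_derivative q) (at s within S)"
  shows "((\<lambda>u. exp (- J u)) has_vector_derivative (- q * exp (- J s))) (at s within S)"
proof -
  have "((exp \<circ> (\<lambda>u. - J u)) has_vector_derivative (- q * exp (- J s))) (at s within S)"
    by (rule field_vector_diff_chain_within[OF has_vector_derivative_minus[OF assms]])
      (auto intro: DERIV_exp has_field_derivative_at_within)
  then show ?thesis by (simp add: o_def)
qed

context loewner_driver
begin

lemma continuous_on_quotient_along:
  assumes "continuous_on S \<gamma>" "continuous_on S \<delta>" "\<And>s. s \<in> S \<Longrightarrow> norm (\<gamma> s) < 1" "\<And>s. s \<in> S \<Longrightarrow> norm (\<delta> s) < 1"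
  shows "continuous_on (S \<times> sphere 0 1) (\<lambda>(s, \<zeta>). 2 / ((1 - \<gamma> s * \<zeta>) * (1 - \<delta> s * \<zeta>)) - (1 :: complex))"
proof -
  have "continuous_on (S \<times> sphere 0 1) (\<lambda>x. \<gamma> (fst x))" "continuous_on (S \<times> sphere 0 1) (\<lambda>x. \<delta> (fst x))"
    by (auto intro!: continuous_on_compose2[OF assms(1)] continuous_on_compose2[OF assms(2)] continuous_intros)
  then show ?thesis
    unfolding case_prod_beta using one_minus_mult_circle_neq_0 assms(3,4)
    by (intro continuous_intros) fastforce+
qed

lemma continuous_on_herglotz_along:
  assumes "continuous_on S \<gamma>" "\<And>s. s \<in> S \<Longrightarrow> norm (\<gamma> s) < 1"
  shows "continuous_on (S \<times> sphere 0 1) (\<lambda>(s, \<zeta>). (cnj \<zeta> + \<gamma> s) / (cnj \<zeta> - \<gamma> s))"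
proof -
  have "continuous_on (S \<times> sphere 0 1) (\<lambda>x. \<gamma> (fst x))"
    by (auto intro!: continuous_on_compose2[OF assms(1)] continuous_intros)
  then show ?thesis
    unfolding case_prod_beta using cnj_circle_minus_neq_0 assms(2)
    by (intro continuous_intros) fastforce+
qed

lemma loewner_quotient_integrable:
  assumes "0 \<le> a" "continuous_on {a..b} \<gamma>" "continuous_on {a..b} \<delta>"
    "\<And>s. s \<in> {a..b} \<Longrightarrow> norm (\<gamma> s) < 1" "\<And>s. s \<in> {a..b} \<Longrightarrow> norm (\<delta> s) < 1"
  shows "(\<lambda>s. loewner_quotient (\<mu> s) (\<gamma> s) (\<delta> s)) integrable_on {a..b}"
  unfolding loewner_quotient_def
  by (rule param_integral_integrable[OF assms(1) continuous_on_quotient_along[OF assms(2-)]])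

text \<open>The difference \<open>\<gamma> - \<delta>\<close> satisfies \<open>(\<gamma> - \<delta>)' = (\<gamma> - \<delta>) q(\<gamma>, \<delta>)\<close> off the jumps, so its product with
\<open>exp (- \<integral> q)\<close> is continuous with vanishing derivative off a finite set, hence constant.\<close>
lemma loewner_curve_diff:
  assumes a: "0 \<le> a" and ab: "a \<le> b"
    and \<gamma>: "loewner_curve \<mu> a b \<gamma>" and \<delta>: "loewner_curve \<mu> a b \<delta>"
  shows "\<gamma> a - \<delta> a = (\<gamma> b - \<delta> b) * exp (- integral {a..b} (\<lambda>s. loewner_quotient (\<mu> s) (\<gamma> s) (\<delta> s)))"
proof -
  let ?Q = "\<lambda>s. loewner_quotient (\<mu> s) (\<gamma> s) (\<delta> s)"
  define J where "J u = integral {a..u} ?Q" for u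
  define E where "E u = (\<gamma> u - \<delta> u) * exp (- J u)" for u
  have \<gamma>': "continuous_on {a..b} \<gamma>" "\<And>s. s \<in> {a..b} \<Longrightarrow> norm (\<gamma> s) < 1"
    and \<delta>': "continuous_on {a..b} \<delta>" "\<And>s. s \<in> {a..b} \<Longrightarrow> norm (\<delta> s) < 1"
    using \<gamma> \<delta> by (auto simp: loewner_curve_def)
  note F = continuous_on_quotient_along[OF \<gamma>'(1) \<delta>'(1) \<gamma>'(2) \<delta>'(2)]
  have "E b = E a"
  proof (rule has_derivative_zero_unique_strong_interval)
    show "finite {s \<in> {0..b}. \<not> weakly_continuous_at \<mu> s}" by (rule finite_discontinuities)
    show "continuous_on {a..b} E"
      unfolding E_def J_def
      by (intro continuous_intros \<gamma>' \<delta>' indefinite_integral_continuous_1 loewner_quotient_integrable a)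
    fix s assume s: "s \<in> {a..b} - {s \<in> {0..b}. \<not> weakly_continuous_at \<mu> s}"
    then have s': "s \<in> {a..b}" "weakly_continuous_at \<mu> s" "0 \<le> s" using a by auto
    have "(J has_vector_derivative ?Q s) (at s within {a..b})"
      unfolding J_def loewner_quotient_def
      by (rule param_integral_derivative[OF a F s'(1,2)])
    then have "(E has_vector_derivative ((\<gamma> s - \<delta> s) * (- ?Q s * exp (- J s)) +
        (loewner_field (\<mu> s) (\<gamma> s) - loewner_field (\<mu> s) (\<delta> s)) * exp (- J s))) (at s within {a..b})"
      unfolding E_def using \<gamma> \<delta> s'
      by (intro has_vector_derivative_mult has_vector_derivative_diff vector_derivative_exp_minus)
        (auto simp: loewner_curve_def)
    moreover have "(\<gamma> s - \<delta> s) * (- ?Q s * exp (- J s)) +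
        (loewner_field (\<mu> s) (\<gamma> s) - loewner_field (\<mu> s) (\<delta> s)) * exp (- J s) = 0"
      using \<gamma>' \<delta>' s' by (simp add: loewner_field_diff algebra_simps)
    ultimately show "(E has_derivative (\<lambda>h. 0)) (at s within {a..b})"
      by (simp add: has_vector_derivative_def)
  qed (use ab in auto)
  then show ?thesis by (simp add: E_def J_def)
qed

section \<open>Existence of backward solutions\<close>

lemma exp_weight_integral:
  fixes L s t :: real
  assumes "0 < L" "s \<le> t"
  shows "((\<lambda>u. L * exp (2 * L * (t - u))) has_integral (exp (2 * L * (t - s)) - 1) / 2) {s..t}"
proof -
  have "((\<lambda>u. L * exp (2 * L * (t - u))) has_integral
      (- exp (2 * L * (t - t)) / 2 - (- exp (2 * L * (t - s)) / 2))) {s..t}"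
    by (rule fundamental_theorem_of_calculus[OF assms(2)])
      (auto intro!: derivative_eq_intros simp: has_real_derivative_iff_has_vector_derivative[symmetric])
  then show ?thesis by (simp add: diff_divide_distrib)
qed

text \<open>The integral equation is \<open>\<gamma>(s) = w exp (- \<integral>\<^sub>s\<^sup>t p\<^sub>u(\<gamma>(u)) du)\<close>. Its right-hand side maps curves in
the closed disk of radius \<open>\<bar>w\<bar>\<close> to such curves, since \<open>Re p\<^sub>u \<ge> 0\<close>. On this disk
\<open>p\<^sub>u\<close> is Lipschitz continuous, uniformly in \<open>u\<close>.\<close>
context
  fixes t :: real and w :: complex
  assumes t: "0 \<le> t" and w: "norm w < 1"
begin

definition picard :: "(real \<Rightarrow> complex) \<Rightarrow> real \<Rightarrow> complex" where
  "picard \<gamma> s = w * exp (- integral {s..t} (\<lambda>u. herglotz_transform (\<mu> u) (\<gamma> u)))"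

definition admissible :: "(real \<Rightarrow> complex) \<Rightarrow> bool" where
  "admissible \<gamma> \<longleftrightarrow> continuous_on {0..t} \<gamma> \<and> (\<forall>s\<in>{0..t}. norm (\<gamma> s) \<le> norm w)"

text \<open>A Lipschitz constant of \<open>p\<^sub>u\<close> on the disk of radius \<open>\<bar>w\<bar>\<close>; the summand \<open>1\<close> makes it positive.\<close>
definition lip :: real where "lip = 2 * C / (1 - norm w)\<^sup>2 + 1"

lemma lip_pos: "0 < lip"
  using mass_nonneg by (simp add: lip_def add_nonneg_pos)

lemma admissible_norm_less: "admissible \<gamma> \<Longrightarrow> s \<in> {0..t} \<Longrightarrow> norm (\<gamma> s) < 1"
  using w unfolding admissible_def by (meson order_le_less_trans)

lemma herglotz_along_continuous_on:
  "admissible \<gamma> \<Longrightarrow> continuous_on ({0..t} \<times> sphere 0 1) (\<lambda>(s, \<zeta>). (cnj \<zeta> + \<gamma> s) / (cnj \<zeta> - \<gamma> s))"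
  using admissible_norm_less by (intro continuous_on_herglotz_along) (auto simp: admissible_def)

lemma herglotz_along_integrable:
  assumes "admissible \<gamma>" "0 \<le> s"
  shows "(\<lambda>u. herglotz_transform (\<mu> u) (\<gamma> u)) integrable_on {s..t}"
proof -
  have "(\<lambda>u. herglotz_transform (\<mu> u) (\<gamma> u)) integrable_on {0..t}"
    unfolding herglotz_transform_def
    by (rule param_integral_integrable[OF order_refl herglotz_along_continuous_on[OF assms(1)]])
  then show ?thesis
    by (rule integrable_subinterval_real) (use assms in auto)
qed

lemma Re_integral_herglotz_nonneg:
  assumes "admissible \<gamma>" "0 \<le> s"
  shows "0 \<le> Re (integral {s..t} (\<lambda>u. herglotz_transform (\<mu> u) (\<gamma> u)))"
proof -
  have "((\<lambda>u. Re (herglotz_transform (\<mu> u) (\<gamma> u))) has_integral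
      Re (integral {s..t} (\<lambda>u. herglotz_transform (\<mu> u) (\<gamma> u)))) {s..t}"
    using has_integral_linear[OF integrable_integral[OF herglotz_along_integrable[OF assms]] bounded_linear_Re]
    by (simp add: o_def)
  then show ?thesis
    by (rule has_integral_nonneg)
      (use assms admissible_norm_less[OF assms(1)] in \<open>auto intro!: Re_herglotz_transform_nonneg\<close>)
qed

lemma norm_picard_le:
  assumes "admissible \<gamma>" "0 \<le> s"
  shows "norm (picard \<gamma> s) \<le> norm w"
  using Re_integral_herglotz_nonneg[OF assms] by (simp add: picard_def norm_mult mult_left_le)

lemma admissible_picard: "admissible \<gamma> \<Longrightarrow> admissible (picard \<gamma>)"
  unfolding admissible_def[of "picard \<gamma>"]
proof (intro conjI ballI)
  assume \<gamma>: "admissible \<gamma>"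
  show "continuous_on {0..t} (picard \<gamma>)"
    unfolding picard_def
    by (intro continuous_intros indefinite_integral_continuous_1' herglotz_along_integrable \<gamma> order_refl)
  show "norm (picard \<gamma> s) \<le> norm w" if "s \<in> {0..t}" for s
    using norm_picard_le[OF \<gamma>] that by simp
qed

lemma picard_contraction:
  assumes \<gamma>: "admissible \<gamma>" and \<delta>: "admissible \<delta>" and s: "s \<in> {0..t}"
  shows "norm (picard \<gamma> s - picard \<delta> s) \<le> integral {s..t} (\<lambda>u. lip * norm (\<gamma> u - \<delta> u))"
proof -
  let ?p = "\<lambda>\<gamma> u. herglotz_transform (\<mu> u) (\<gamma> u)"
  have s0: "0 \<le> s" using s by simp
  have "norm (picard \<gamma> s - picard \<delta> s) =
      norm w * norm (exp (- integral {s..t} (?p \<gamma>)) - exp (- integral {s..t} (?p \<delta>)))"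
    by (simp add: picard_def norm_mult flip: right_diff_distrib)
  also have "\<dots> \<le> 1 * norm (integral {s..t} (?p \<gamma>) - integral {s..t} (?p \<delta>))"
    using w by (intro mult_mono norm_exp_minus_diff_le Re_integral_herglotz_nonneg \<gamma> \<delta> s0) auto
  also have "\<dots> = norm (integral {s..t} (\<lambda>u. ?p \<gamma> u - ?p \<delta> u))"
    by (simp add: integral_diff herglotz_along_integrable[OF \<gamma> s0] herglotz_along_integrable[OF \<delta> s0])
  also have "\<dots> \<le> integral {s..t} (\<lambda>u. lip * norm (\<gamma> u - \<delta> u))"
  proof (rule integral_norm_bound_integral)
    show "(\<lambda>u. ?p \<gamma> u - ?p \<delta> u) integrable_on {s..t}"
      by (intro integrable_diff herglotz_along_integrable \<gamma> \<delta> s0)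
    show "(\<lambda>u. lip * norm (\<gamma> u - \<delta> u)) integrable_on {s..t}"
      using \<gamma> \<delta> s by (intro integrable_continuous_real continuous_intros)
        (auto simp: admissible_def elim: continuous_on_subset)
    fix u assume u: "u \<in> {s..t}"
    have "norm (?p \<gamma> u - ?p \<delta> u) \<le> 2 * C / (1 - norm w)\<^sup>2 * norm (\<gamma> u - \<delta> u)"
      using \<gamma> \<delta> u s w by (intro herglotz_transform_diff_le) (auto simp: admissible_def)
    also have "\<dots> \<le> lip * norm (\<gamma> u - \<delta> u)"
      by (intro mult_right_mono) (auto simp: lip_def)
    finally show "norm (?p \<gamma> u - ?p \<delta> u) \<le> lip * norm (\<gamma> u - \<delta> u)" .
  qed
  finally show ?thesis .
qed

text \<open>In the norm weighted by \<open>exp (2L(t - s))\<close>, with \<open>L\<close> the Lipschitz constant, the Picard operator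
contracts distances by the factor \<open>1/2\<close> on the whole interval, because
\<open>\<integral>\<^sub>s\<^sup>t L exp (2L(t - u)) du\<close> is less than half of the weight at \<open>s\<close>. So the iterates converge
geometrically and uniformly.\<close>
lemma picard_fixed_point: "\<exists>\<gamma>. admissible \<gamma> \<and> (\<forall>s\<in>{0..t}. \<gamma> s = picard \<gamma> s)"
proof -
  define \<Gamma> where "\<Gamma> n = (picard ^^ n) (\<lambda>_. w)" for n
  have \<Gamma>_Suc: "\<Gamma> (Suc n) = picard (\<Gamma> n)" for n by (simp add: \<Gamma>_def)
  have \<Gamma>: "admissible (\<Gamma> n)" for n
  proof (induction n)
    case 0
    show ?case by (simp add: \<Gamma>_def admissible_def)
  qed (simp add: \<Gamma>_Suc admissible_picard)
  have cont: "continuous_on {0..t} (\<Gamma> n)" for n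
    using \<Gamma> by (simp add: admissible_def)
  have step: "norm (\<Gamma> (Suc n) s - \<Gamma> n s) \<le> 2 * (1 / 2) ^ n * exp (2 * lip * (t - s))" if "s \<in> {0..t}" for n s
    using that
  proof (induction n arbitrary: s)
    case 0
    have "norm (\<Gamma> (Suc 0) s - \<Gamma> 0 s) \<le> norm (\<Gamma> (Suc 0) s) + norm (\<Gamma> 0 s)"
      by (rule norm_triangle_ineq4)
    also have "\<dots> \<le> 2 * 1"
      using admissible_norm_less[OF \<Gamma> 0, of 0] admissible_norm_less[OF \<Gamma> 0, of "Suc 0"] by linarith
    also have "\<dots> \<le> 2 * exp (2 * lip * (t - s))"
      using 0 lip_pos by (intro mult_left_mono) auto
    finally show ?case by simp
  next
    case (Suc n)
    have "norm (\<Gamma> (Suc (Suc n)) s - \<Gamma> (Suc n) s) \<le> integral {s..t} (\<lambda>u. lip * norm (\<Gamma> (Suc n) u - \<Gamma> n u))"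
      unfolding \<Gamma>_Suc[of "Suc n"] using picard_contraction[OF \<Gamma> \<Gamma> Suc.prems, of "Suc n" n] by (simp add: \<Gamma>_Suc[of n])
    also have "\<dots> \<le> (2 * (1 / 2) ^ n) * ((exp (2 * lip * (t - s)) - 1) / 2)"
    proof (rule has_integral_le)
      show "((\<lambda>u. lip * norm (\<Gamma> (Suc n) u - \<Gamma> n u)) has_integral
          integral {s..t} (\<lambda>u. lip * norm (\<Gamma> (Suc n) u - \<Gamma> n u))) {s..t}"
        using Suc.prems
        by (intro integrable_integral integrable_continuous_real continuous_intros continuous_on_subset[OF cont]) auto
      show "((\<lambda>u. (2 * (1 / 2) ^ n) * (lip * exp (2 * lip * (t - u)))) has_integral
          (2 * (1 / 2) ^ n) * ((exp (2 * lip * (t - s)) - 1) / 2)) {s..t}"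
        using Suc.prems by (intro has_integral_mult_right exp_weight_integral lip_pos) auto
      show "lip * norm (\<Gamma> (Suc n) u - \<Gamma> n u) \<le> (2 * (1 / 2) ^ n) * (lip * exp (2 * lip * (t - u)))"
        if "u \<in> {s..t}" for u
        using mult_left_mono[OF Suc.IH[of u] less_imp_le[OF lip_pos]] that Suc.prems by (simp add: mult_ac)
    qed
    also have "\<dots> \<le> 2 * (1 / 2) ^ Suc n * exp (2 * lip * (t - s))"
      by (simp add: field_simps)
    finally show ?case .
  qed
  have "uniform_limit {0..t} (\<lambda>n s. \<Sum>i<n. \<Gamma> (Suc i) s - \<Gamma> i s) (\<lambda>s. \<Sum>i. \<Gamma> (Suc i) s - \<Gamma> i s) sequentially"
  proof (rule Weierstrass_m_test)
    show "norm (\<Gamma> (Suc n) s - \<Gamma> n s) \<le> 2 * exp (2 * lip * t) * (1 / 2) ^ n" if "s \<in> {0..t}" for n s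
    proof -
      have "exp (2 * lip * (t - s)) \<le> exp (2 * lip * t)" using that lip_pos by simp
      then have "2 * (1 / 2) ^ n * exp (2 * lip * (t - s)) \<le> 2 * (1 / 2) ^ n * exp (2 * lip * t)"
        by (intro mult_left_mono) auto
      also have "\<dots> = 2 * exp (2 * lip * t) * (1 / 2) ^ n" by (simp only: mult_ac)
      finally show ?thesis using step[OF that, of n] by (rule order_trans[rotated])
    qed
    show "summable (\<lambda>n. 2 * exp (2 * lip * t) * (1 / 2 :: real) ^ n)"
      by (intro summable_mult summable_geometric) auto
  qed
  moreover have "(\<Sum>i<n. \<Gamma> (Suc i) s - \<Gamma> i s) = \<Gamma> n s - \<Gamma> 0 s" for n s
    by (rule sum_lessThan_telescope[of "\<lambda>i. \<Gamma> i s"])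
  ultimately obtain D where D: "uniform_limit {0..t} (\<lambda>n s. \<Gamma> n s - \<Gamma> 0 s) D sequentially"
    by auto
  define \<gamma> where "\<gamma> s = D s + w" for s
  have lim: "uniform_limit {0..t} \<Gamma> \<gamma> sequentially"
    using uniform_limit_add[OF D uniform_limit_const[where c = "\<lambda>_. w"]] by (simp add: \<Gamma>_def[abs_def] \<gamma>_def[abs_def])
  have lim_pt: "(\<lambda>n. \<Gamma> n s) \<longlonglongrightarrow> \<gamma> s" if "s \<in> {0..t}" for s
    by (rule tendsto_uniform_limitI[OF lim that])
  have \<gamma>: "admissible \<gamma>"
    unfolding admissible_def
  proof (intro conjI ballI)
    show "continuous_on {0..t} \<gamma>"
      by (rule uniform_limit_theorem[OF _ lim]) (auto simp: cont)
    show "norm (\<gamma> s) \<le> norm w" if "s \<in> {0..t}" for s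
      using \<Gamma> that by (intro tendsto_upperbound[OF tendsto_norm[OF lim_pt[OF that]]]) (auto simp: admissible_def)
  qed
  have "\<gamma> s = picard \<gamma> s" if s: "s \<in> {0..t}" for s
  proof (rule LIMSEQ_unique)
    show "(\<lambda>n. \<Gamma> (Suc n) s) \<longlonglongrightarrow> \<gamma> s" by (rule LIMSEQ_Suc[OF lim_pt[OF s]])
    show "(\<lambda>n. \<Gamma> (Suc n) s) \<longlonglongrightarrow> picard \<gamma> s"
    proof (rule tendstoI)
      fix e :: real assume e: "e > 0"
      define e' where "e' = e / (lip * t + 1)"
      have lt: "0 \<le> lip * t" using lip_pos t by simp
      have e': "e' > 0" "e' * (lip * t) < e" using e lt by (auto simp: e'_def field_simps)
      show "\<forall>\<^sub>F n in sequentially. dist (\<Gamma> (Suc n) s) (picard \<gamma> s) < e"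
        using uniform_limitD[OF lim e'(1)]
      proof eventually_elim
        case (elim n)
        have "norm (picard (\<Gamma> n) s - picard \<gamma> s) \<le> integral {s..t} (\<lambda>u. lip * norm (\<Gamma> n u - \<gamma> u))"
          by (rule picard_contraction[OF \<Gamma> \<gamma> s])
        also have "\<dots> \<le> integral {s..t} (\<lambda>u. lip * e')"
          using elim s lip_pos \<gamma>
          by (intro integral_le integrable_continuous_real continuous_intros continuous_on_subset[OF cont] mult_left_mono)
            (auto simp: admissible_def dist_norm less_imp_le elim: continuous_on_subset)
        also have "\<dots> = lip * e' * (t - s)" using s by simp
        also have "\<dots> \<le> lip * e' * t" using s lip_pos e' by (intro mult_left_mono) auto
        also have "\<dots> < e" using e' by (simp add: mult_ac)
        finally show ?case by (simp add: \<Gamma>_Suc dist_norm)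
      qed
    qed
  qed
  with \<gamma> show ?thesis by blast
qed

text \<open>The last estimate says that short backward flows are uniformly close to the identity on smaller
disks. It is what \<open>backflow_extend\<close> needs.\<close>
lemma backward_curve_exists:
  "\<exists>\<gamma>. loewner_curve \<mu> 0 t \<gamma> \<and> \<gamma> t = w \<and>
     (\<forall>s\<in>{0..t}. norm (\<gamma> s) \<le> norm w \<and> norm (\<gamma> s - w) \<le> (2 / (1 - norm w) + 1) * C * (t - s))"
proof -
  obtain \<gamma> where \<gamma>: "admissible \<gamma>" and fp: "\<And>s. s \<in> {0..t} \<Longrightarrow> \<gamma> s = picard \<gamma> s"
    using picard_fixed_point by blast
  define P where "P u = herglotz_transform (\<mu> u) (\<gamma> u)" for u
  define J where "J u = integral {0..u} P" for u
  have P: "P integrable_on {s..t}" if "0 \<le> s" for s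
    unfolding P_def by (rule herglotz_along_integrable[OF \<gamma> that])
  have picard_J: "\<gamma> s = w * exp (- J t) * exp (J s)" if "s \<in> {0..t}" for s
  proof -
    have "integral {0..s} P + integral {s..t} P = integral {0..t} P"
      using that P[of 0] by (intro Henstock_Kurzweil_Integration.integral_combine) auto
    then have "integral {s..t} P = J t - J s" by (simp add: J_def algebra_simps)
    then have "\<gamma> s = w * exp (- (J t - J s))"
      using fp[OF that] by (simp add: picard_def P_def[symmetric])
    also have "exp (- (J t - J s)) = exp (- J t) * exp (J s)"
      by (simp flip: exp_add)
    finally show ?thesis by (simp only: mult.assoc)
  qed
  have "loewner_curve \<mu> 0 t \<gamma>"
    unfolding loewner_curve_def
  proof (intro conjI ballI impI)
    show "continuous_on {0..t} \<gamma>" using \<gamma> by (simp add: admissible_def)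
    fix s assume s: "s \<in> {0..t}"
    show "norm (\<gamma> s) < 1" by (rule admissible_norm_less[OF \<gamma> s])
    assume wc: "weakly_continuous_at \<mu> s"
    have "(J has_vector_derivative P s) (at s within {0..t})"
      unfolding J_def P_def herglotz_transform_def
      by (rule param_integral_derivative[OF order_refl herglotz_along_continuous_on[OF \<gamma>] s wc])
    from vector_derivative_exp_minus[OF has_vector_derivative_minus[OF this]]
    have "((\<lambda>u. exp (J u)) has_vector_derivative P s * exp (J s)) (at s within {0..t})" by simp
    from has_vector_derivative_mult_right[OF this, of "w * exp (- J t)"]
    have "((\<lambda>u. w * exp (- J t) * exp (J u)) has_vector_derivative w * exp (- J t) * exp (J s) * P s) (at s within {0..t})"
      by (simp only: mult_ac)
    then have "((\<lambda>u. w * exp (- J t) * exp (J u)) has_vector_derivative loewner_field (\<mu> s) (\<gamma> s)) (at s within {0..t})"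
      unfolding picard_J[OF s, symmetric] by (simp only: loewner_field_eq P_def)
    then show "(\<gamma> has_vector_derivative loewner_field (\<mu> s) (\<gamma> s)) (at s within {0..t})"
      using s by (rule has_vector_derivative_transform[rotated 2]) (rule picard_J)
  qed
  moreover have "\<gamma> t = w"
    using fp[of t] t by (simp add: picard_def)
  moreover have "norm (\<gamma> s) \<le> norm w \<and> norm (\<gamma> s - w) \<le> (2 / (1 - norm w) + 1) * C * (t - s)" if s: "s \<in> {0..t}" for s
  proof
    show "norm (\<gamma> s) \<le> norm w" using \<gamma> s by (simp add: admissible_def)
    have s0: "0 \<le> s" using s by simp
    have "norm (\<gamma> s - w) = norm w * norm (exp (- integral {s..t} P) - exp (- 0))"
      unfolding fp[OF s] picard_def P_def[symmetric] by (simp flip: norm_mult add: algebra_simps)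
    also have "\<dots> \<le> 1 * norm (integral {s..t} P - 0)"
      using w Re_integral_herglotz_nonneg[OF \<gamma> s0] unfolding P_def
      by (intro mult_mono norm_exp_minus_diff_le) auto
    also have "\<dots> \<le> integral {s..t} (\<lambda>u. (2 / (1 - norm w) + 1) * C)"
      unfolding mult_1 diff_zero
    proof (rule integral_norm_bound_integral[OF P[OF s0]])
      show "norm (P u) \<le> (2 / (1 - norm w) + 1) * C" if "u \<in> {s..t}" for u
        unfolding P_def using \<gamma> that s w by (intro norm_herglotz_transform_le) (auto simp: admissible_def)
    qed (rule integrable_const_ivl)
    also have "\<dots> = (2 / (1 - norm w) + 1) * C * (t - s)" using s by simp
    finally show "norm (\<gamma> s - w) \<le> (2 / (1 - norm w) + 1) * C * (t - s)" .
  qed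
  ultimately show ?thesis by blast
qed

end

end

section \<open>The backward flow\<close>

context loewner_driver
begin

definition backflow :: "real \<Rightarrow> real \<Rightarrow> complex \<Rightarrow> complex" where
  "backflow s t w = (THE z. \<exists>\<gamma>. loewner_curve \<mu> s t \<gamma> \<and> \<gamma> t = w \<and> \<gamma> s = z)"

lemma backflow_eq:
  assumes "0 \<le> s" "s \<le> t" "loewner_curve \<mu> s t \<gamma>"
  shows "backflow s t (\<gamma> t) = \<gamma> s"
  unfolding backflow_def
proof (rule the_equality)
  fix z assume "\<exists>\<delta>. loewner_curve \<mu> s t \<delta> \<and> \<delta> t = \<gamma> t \<and> \<delta> s = z"
  then show "z = \<gamma> s" using loewner_curve_diff[OF assms(1,2) _ assms(3)] by force
qed (use assms in blast)

lemma backflow_curve: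
  assumes t: "0 \<le> t" and w: "norm w < 1"
  shows "loewner_curve \<mu> 0 t (\<lambda>s. backflow s t w)"
    and "backflow t t w = w"
    and "s \<in> {0..t} \<Longrightarrow> norm (backflow s t w) \<le> norm w"
    and "s \<in> {0..t} \<Longrightarrow> norm (backflow s t w - w) \<le> (2 / (1 - norm w) + 1) * C * (t - s)"
proof -
  obtain \<gamma> where \<gamma>: "loewner_curve \<mu> 0 t \<gamma>" "\<gamma> t = w"
    "\<And>s. s \<in> {0..t} \<Longrightarrow> norm (\<gamma> s) \<le> norm w \<and> norm (\<gamma> s - w) \<le> (2 / (1 - norm w) + 1) * C * (t - s)"
    using backward_curve_exists[OF t w] by blast
  have eq: "backflow s t w = \<gamma> s" if "s \<in> {0..t}" for s
    using that backflow_eq[OF _ _ loewner_curve_subinterval[OF \<gamma>(1)], of s] \<gamma>(2) by auto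
  show "loewner_curve \<mu> 0 t (\<lambda>s. backflow s t w)"
    by (rule loewner_curve_cong[OF \<gamma>(1) eq])
  show "backflow t t w = w" using eq[of t] \<gamma>(2) t by simp
  show "s \<in> {0..t} \<Longrightarrow> norm (backflow s t w) \<le> norm w"
    and "s \<in> {0..t} \<Longrightarrow> norm (backflow s t w - w) \<le> (2 / (1 - norm w) + 1) * C * (t - s)"
    using eq \<gamma>(3) by auto
qed

lemma norm_backflow_less:
  "0 \<le> s \<Longrightarrow> s \<le> t \<Longrightarrow> norm w < 1 \<Longrightarrow> norm (backflow s t w) < 1"
  using backflow_curve(3)[of t w s] by auto

lemma backflow_comp:
  assumes "0 \<le> r" "r \<le> s" "s \<le> t" "norm w < 1"
  shows "backflow r s (backflow s t w) = backflow r t w"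
  using assms backflow_eq[OF _ _ loewner_curve_subinterval[OF backflow_curve(1)], of r s t w] by auto

lemma backflow_diff:
  assumes "0 \<le> s" "s \<le> t" "norm z < 1" "norm w < 1"
  shows "backflow s t z - backflow s t w =
    (z - w) * exp (- integral {s..t} (\<lambda>u. loewner_quotient (\<mu> u) (backflow u t z) (backflow u t w)))"
proof -
  have t: "0 \<le> t" using assms by simp
  have "loewner_curve \<mu> s t (\<lambda>u. backflow u t v)" if "norm v < 1" for v
    using that assms by (intro loewner_curve_subinterval[OF backflow_curve(1)]) auto
  from loewner_curve_diff[OF assms(1,2) this[OF assms(3)] this[OF assms(4)]]
  show ?thesis using backflow_curve(2)[OF t] assms by simp
qed

lemma inj_on_backflow:
  assumes "0 \<le> s" "s \<le> t"
  shows "inj_on (backflow s t) (ball 0 1)"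
proof (rule inj_onI)
  fix z w :: complex assume "z \<in> ball 0 1" "w \<in> ball 0 1" "backflow s t z = backflow s t w"
  then show "z = w" using backflow_diff[OF assms, of z w] by simp
qed

lemma backflow_quotient_integrable:
  assumes "0 \<le> s" "s \<le> t" "norm z < 1" "norm w < 1"
  shows "(\<lambda>u. loewner_quotient (\<mu> u) (backflow u t z) (backflow u t w)) integrable_on {s..t}"
proof -
  have "loewner_curve \<mu> s t (\<lambda>u. backflow u t v)" if "norm v < 1" for v
    using that assms by (intro loewner_curve_subinterval[OF backflow_curve(1)]) auto
  from this[OF assms(3)] this[OF assms(4)] show ?thesis
    using assms by (intro loewner_quotient_integrable) (auto simp: loewner_curve_def)
qed

text \<open>By \<open>backflow_diff\<close> the difference quotient between \<open>z\<close> and \<open>w\<close> is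
\<open>exp (- \<integral> q\<^sub>u(\<phi>\<^sub>u\<^sub>t(z), \<phi>\<^sub>u\<^sub>t(w)) du)\<close>. The same identity shows that \<open>\<phi>\<^sub>u\<^sub>t(z)\<close> tends to
\<open>\<phi>\<^sub>u\<^sub>t(w)\<close> uniformly in \<open>u\<close> as \<open>z\<close> tends to \<open>w\<close>, and then the integrals converge.\<close>
lemma backflow_has_derivative:
  assumes s: "0 \<le> s" "s \<le> t" and w: "norm w < 1"
  shows "(backflow s t has_field_derivative
     exp (- integral {s..t} (\<lambda>u. loewner_quotient (\<mu> u) (backflow u t w) (backflow u t w)))) (at w)"
proof -
  define \<rho> where "\<rho> = (1 + norm w) / 2"
  have \<rho>: "\<rho> < 1" "norm w < \<rho>" using w by (auto simp: \<rho>_def)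
  define Q where "Q z u = loewner_quotient (\<mu> u) (backflow u t z) (backflow u t w)" for z u
  (* B bounds the divided difference along the curves, so backflow u t stretches the distance
     from z to w at most by the factor exp (B t), and the integrals of the divided differences
     for z and for w differ by at most K t times this distance *)
  define B where "B = (2 / (1 - \<rho>)\<^sup>2 + 1) * C"
  define K where "K = 2 * C / (1 - \<rho>) ^ 3 * exp (B * t)"
  have B0: "0 \<le> B" using mass_nonneg by (simp add: B_def)
  have in_\<rho>: "norm (backflow u t z) \<le> \<rho>" if "norm z \<le> \<rho>" "u \<in> {0..t}" for u z
    using backflow_curve(3)[of t z u] that \<rho> s by auto
  have int: "Q z integrable_on {u..t}" if "norm z \<le> \<rho>" "0 \<le> u" "u \<le> t" for z u
    unfolding Q_def using that \<rho> w by (intro backflow_quotient_integrable) auto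
  have close: "norm (backflow u t z - backflow u t w) \<le> norm (z - w) * exp (B * t)"
    if z: "norm z \<le> \<rho>" and u: "u \<in> {0..t}" for u z
  proof -
    have z1: "norm z < 1" using z \<rho> by simp
    have "norm (integral {u..t} (Q z)) \<le> integral {u..t} (\<lambda>_. B)"
    proof (rule integral_norm_bound_integral)
      show "norm (Q z v) \<le> B" if "v \<in> {u..t}" for v
        unfolding Q_def B_def using that u z \<rho>
        by (intro norm_loewner_quotient_le in_\<rho>) auto
    qed (use int z u in auto)
    also have "\<dots> \<le> B * t" using u B0 by (simp add: mult.commute[of _ B] mult_left_mono)
    finally have "norm (exp (- integral {u..t} (Q z))) \<le> exp (B * t)"
      using norm_exp[of "- integral {u..t} (Q z)"] by (simp only: norm_minus_cancel) (meson exp_le_cancel_iff order_trans)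
    moreover have "backflow u t z - backflow u t w = (z - w) * exp (- integral {u..t} (Q z))"
      unfolding Q_def using u by (intro backflow_diff z1 w) auto
    ultimately show ?thesis
      by (simp add: norm_mult mult_left_mono)
  qed
  have int_close: "norm (integral {s..t} (Q z) - integral {s..t} (Q w)) \<le> K * norm (z - w) * t" if z: "norm z \<le> \<rho>" for z
  proof -
    have K0: "0 \<le> K" using mass_nonneg \<rho> by (simp add: K_def)
    have "integral {s..t} (Q z) - integral {s..t} (Q w) = integral {s..t} (\<lambda>u. Q z u - Q w u)"
      using int z s \<rho> by (intro Henstock_Kurzweil_Integration.integral_diff[symmetric]) auto
    also have "norm \<dots> \<le> integral {s..t} (\<lambda>_. K * norm (z - w))"
    proof (rule integral_norm_bound_integral)
      show "(\<lambda>u. Q z u - Q w u) integrable_on {s..t}" using int z s \<rho> by (intro integrable_diff) auto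
      fix u assume u: "u \<in> {s..t}"
      have "norm (Q z u - Q w u) \<le> 2 * C / (1 - \<rho>) ^ 3 * norm (backflow u t z - backflow u t w)"
        unfolding Q_def using u s z \<rho> by (intro loewner_quotient_diff_le in_\<rho>) auto
      also have "\<dots> \<le> 2 * C / (1 - \<rho>) ^ 3 * (norm (z - w) * exp (B * t))"
        using close[OF z] u s mass_nonneg \<rho> by (intro mult_left_mono) auto
      finally show "norm (Q z u - Q w u) \<le> K * norm (z - w)" by (simp add: K_def mult_ac)
    qed (rule integrable_const_ivl)
    also have "\<dots> = K * norm (z - w) * (t - s)" using s by simp
    also have "\<dots> \<le> K * norm (z - w) * t" using s K0 by (intro mult_left_mono) auto
    finally show ?thesis .
  qed
  have ev: "\<forall>\<^sub>F z in at w. norm z \<le> \<rho>"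
    using tendsto_norm[OF tendsto_ident_at[of w UNIV]] \<rho>(2)
    by (rule eventually_mono[OF order_tendstoD(2)]) simp
  have "((\<lambda>z. integral {s..t} (Q z) - integral {s..t} (Q w)) \<longlongrightarrow> 0) (at w)"
  proof (rule Lim_null_comparison)
    show "\<forall>\<^sub>F z in at w. norm (integral {s..t} (Q z) - integral {s..t} (Q w)) \<le> K * norm (z - w) * t"
      using ev by eventually_elim (rule int_close)
    have "((\<lambda>z. K * norm (z - w) * t) \<longlongrightarrow> K * norm (w - w) * t) (at w)"
      by (intro tendsto_intros)
    then show "((\<lambda>z. K * norm (z - w) * t) \<longlongrightarrow> 0) (at w)" by simp
  qed
  then have "((\<lambda>z. integral {s..t} (Q z)) \<longlongrightarrow> integral {s..t} (Q w)) (at w)"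
    by (rule LIM_zero_cancel)
  then have lim: "((\<lambda>z. exp (- integral {s..t} (Q z))) \<longlongrightarrow> exp (- integral {s..t} (Q w))) (at w)"
    by (intro tendsto_intros)
  have ev_ne: "\<forall>\<^sub>F z in at w. z \<noteq> w" by (simp add: eventually_at_filter)
  have "\<forall>\<^sub>F z in at w. exp (- integral {s..t} (Q z)) = (backflow s t z - backflow s t w) / (z - w)"
    using ev ev_ne
  proof eventually_elim
    case (elim z)
    then show ?case
      using backflow_diff[OF s _ w, of z] \<rho> by (simp add: Q_def[abs_def])
  qed
  with lim have "((\<lambda>z. (backflow s t z - backflow s t w) / (z - w)) \<longlongrightarrow> exp (- integral {s..t} (Q w))) (at w)"
    by (rule Lim_transform_eventually)
  then show ?thesis by (simp add: has_field_derivative_iff Q_def[abs_def])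
qed

lemma backflow_holomorphic: "0 \<le> s \<Longrightarrow> s \<le> t \<Longrightarrow> backflow s t holomorphic_on ball 0 1"
  using backflow_has_derivative by (fastforce simp: holomorphic_on_open)

lemma backflow_0: "0 \<le> s \<Longrightarrow> s \<le> t \<Longrightarrow> backflow s t 0 = 0"
  using backflow_curve(3)[of t 0 s] by simp

lemma backflow_image_subset: "0 \<le> s \<Longrightarrow> s \<le> t \<Longrightarrow> backflow s t ` ball 0 1 \<subseteq> ball 0 1"
  using norm_backflow_less by auto

text \<open>Every point of the disk has a forward solution for a short time. It is found by solving
\<open>\<phi>(x) = w\<close> with \<open>\<phi> = backflow t (t + \<epsilon>)\<close>, that is, \<open>x - \<phi>(x) + w = x\<close>: for small
\<open>\<epsilon>\<close> the map \<open>\<phi>\<close> is so close to the identity that the left-hand side maps a small closed disk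
around \<open>w\<close> to itself, and Brouwer's theorem applies.\<close>
lemma backflow_extend:
  assumes t: "0 \<le> t" and w: "norm w < 1"
  obtains \<epsilon> w' where "0 < \<epsilon>" "norm w' < 1" "backflow t (t + \<epsilon>) w' = w"
proof -
  (* half the distance of w to the circle: points of the closed disk of radius r around w stay
     at distance r from the circle *)
  define r where "r = (1 - norm w) / 2"
  have r: "0 < r" using w by (simp add: r_def)
  define B where "B = (2 / r + 1) * C"
  have B: "0 \<le> B" using mass_nonneg r by (simp add: B_def)
  define \<epsilon> where "\<epsilon> = r / (B + 1)"
  have \<epsilon>: "0 < \<epsilon>" "B * \<epsilon> \<le> r" using r B by (auto simp: \<epsilon>_def field_simps)
  have in_ball: "norm x \<le> 1 - r" if "x \<in> cball w r" for x
  proof -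
    have "norm x \<le> norm w + norm (x - w)" by (rule norm_triangle_sub)
    also have "\<dots> \<le> norm w + r" using that by (simp add: dist_norm norm_minus_commute)
    also have "\<dots> = 1 - r" by (simp add: r_def field_simps)
    finally show ?thesis .
  qed
  have cball_sub: "cball w r \<subseteq> ball 0 1" using in_ball r by fastforce
  let ?h = "\<lambda>x. x - backflow t (t + \<epsilon>) x + w"
  have "continuous_on (cball w r) ?h"
    using t \<epsilon> by (intro continuous_intros holomorphic_on_imp_continuous_on
      holomorphic_on_subset[OF backflow_holomorphic cball_sub]) auto
  moreover have "?h \<in> cball w r \<rightarrow> cball w r"
  proof
    fix x assume x: "x \<in> cball w r"
    then have nx: "norm x \<le> 1 - r" "norm x < 1" using in_ball r by fastforce+
    have "norm (backflow t (t + \<epsilon>) x - x) \<le> (2 / (1 - norm x) + 1) * C * (t + \<epsilon> - t)"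
      using t \<epsilon> nx by (intro backflow_curve(4)) auto
    also have "\<dots> \<le> B * \<epsilon>"
      unfolding B_def using nx r \<epsilon> mass_nonneg
      by (intro mult_mono add_mono divide_left_mono) auto
    finally have "norm (backflow t (t + \<epsilon>) x - x) \<le> r" using \<epsilon>(2) by simp
    then show "?h x \<in> cball w r" by (simp add: dist_norm algebra_simps)
  qed
  ultimately obtain x where x: "x \<in> cball w r" "?h x = x"
    using brouwer_ball[OF r] by blast
  then have "backflow t (t + \<epsilon>) x = w" by (simp add: algebra_simps)
  moreover have "norm x < 1" using cball_sub x(1) by auto
  ultimately show thesis using that \<epsilon>(1) by blast
qed

end

section \<open>The forward flow and the hulls\<close>

locale loewner_flow = loewner_driver +
  fixes g :: "real \<Rightarrow> complex \<Rightarrow> complex" and T :: "complex \<Rightarrow> ereal"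
  assumes maximal: "z \<in> ball 0 1 \<Longrightarrow> maximal_loewner_solution \<mu> z (T z) (\<lambda>t. g t z)"
begin

lemma flow_curve:
  assumes z: "norm z < 1" and t: "0 \<le> t" "ereal t < T z"
  shows "loewner_curve \<mu> 0 t (\<lambda>s. g s z)"
proof -
  have sol: "loewner_solution \<mu> z (T z) (\<lambda>t. g t z)"
    using maximal[of z] z by (simp add: maximal_loewner_solution_def)
  have less: "ereal s < T z" if "s \<le> t" for s
    using that t(2) by (meson ereal_less_eq(3) order_le_less_trans)
  show ?thesis
    using sol less unfolding loewner_curve_def loewner_solution_def
    by (auto elim!: continuous_on_subset
        intro!: has_vector_derivative_within_subset[of "\<lambda>s. g s z" _ _ "{0..}" "{0..t}"])
qed

lemma flow_start: "norm z < 1 \<Longrightarrow> g 0 z = z"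
  using maximal[of z] by (auto simp: maximal_loewner_solution_def loewner_solution_def)

lemma backflow_flow:
  assumes "norm z < 1" "0 \<le> t" "ereal t < T z"
  shows "norm (g t z) < 1" and "backflow 0 t (g t z) = z"
  using flow_curve[OF assms] backflow_eq[OF order_refl assms(2) flow_curve[OF assms]] flow_start assms
  by (auto simp: loewner_curve_def)

lemma lifetime_ge:
  assumes z: "norm z < 1" and b: "0 \<le> b" and \<gamma>: "loewner_curve \<mu> 0 b \<gamma>" "\<gamma> 0 = z"
  shows "ereal b \<le> T z"
proof -
  have "loewner_solution \<mu> z (ereal b) \<gamma>"
    unfolding loewner_solution_def
  proof (intro conjI allI impI)
    show "continuous_on {t. 0 \<le> t \<and> ereal t < ereal b} \<gamma>"
      using \<gamma>(1) by (auto simp: loewner_curve_def elim!: continuous_on_subset)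
    fix s assume "0 \<le> s \<and> ereal s < ereal b"
    then show "\<gamma> s \<in> ball 0 1" using \<gamma>(1) by (auto simp: loewner_curve_def)
  next
    fix s assume s: "0 \<le> s \<and> ereal s < ereal b \<and> weakly_continuous_at \<mu> s"
    then have "(\<gamma> has_vector_derivative loewner_field (\<mu> s) (\<gamma> s)) (at s within {0..b})"
      using \<gamma>(1) by (auto simp: loewner_curve_def)
    moreover have "at s within {0..b} = at s within {0..}"
      using s by (intro at_within_nhd[of s "{..<b}"]) auto
    ultimately show "(\<gamma> has_vector_derivative loewner_field (\<mu> s) (\<gamma> s)) (at s within {0..})" by simp
  qed (rule \<gamma>(2))
  then show ?thesis using maximal[of z] z by (auto simp: maximal_loewner_solution_def)
qed

text \<open>A backward curve that ends at \<open>w\<close> at time \<open>t\<close> only shows that its starting point lives up to \<open>t\<close>.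
Choosing \<open>w'\<close> with \<open>backflow t (t + \<epsilon>) w' = w\<close>, the curve that ends at \<open>w'\<close> at time \<open>t + \<epsilon>\<close> starts
at the same point, so the lifetime is strictly larger than \<open>t\<close>.\<close>
lemma flow_backflow:
  assumes t: "0 \<le> t" and w: "norm w < 1"
  shows "ereal t < T (backflow 0 t w)" and "g t (backflow 0 t w) = w"
proof -
  obtain \<epsilon> w' where \<epsilon>: "0 < \<epsilon>" "norm w' < 1" "backflow t (t + \<epsilon>) w' = w"
    using backflow_extend[OF t w] by blast
  let ?z = "backflow 0 t w"
  have z: "norm ?z < 1" using norm_backflow_less[OF order_refl t w] .
  have "backflow 0 (t + \<epsilon>) w' = ?z"
    using backflow_comp[of 0 t "t + \<epsilon>" w'] \<epsilon> t by simp
  then have "ereal (t + \<epsilon>) \<le> T ?z"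
    using t \<epsilon> by (intro lifetime_ge[OF z _ backflow_curve(1)[of _ w']]) auto
  then show *: "ereal t < T ?z" using \<epsilon>(1)
    by (meson ereal_less(2) ereal_less_ereal_Ex less_add_same_cancel1 less_ereal.simps(1) order_less_le_trans)
  show "g t ?z = w"
    using inj_onD[OF inj_on_backflow[OF order_refl t] backflow_flow(2)[OF z t *]] backflow_flow(1)[OF z t *] w
    by simp
qed

lemma backflow_image: "0 \<le> t \<Longrightarrow> backflow 0 t ` ball 0 1 = {z \<in> ball 0 1. ereal t < T z}"
proof (intro equalityI subsetI)
  fix z assume t: "0 \<le> t" and z: "z \<in> {z \<in> ball 0 1. ereal t < T z}"
  then show "z \<in> backflow 0 t ` ball 0 1"
    using backflow_flow[of z t] by (intro image_eqI[of _ _ "g t z"]) auto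
qed (auto simp: flow_backflow norm_backflow_less)

text \<open>The set of points that live longer than \<open>t\<close> is the image of the disk under an injective
holomorphic map, hence open. So the closure that enters the hull adds no point of the disk.\<close>
lemma flow_domain:
  assumes t: "0 \<le> t"
  shows "ball 0 1 - loewner_hull T t = {z \<in> ball 0 1. ereal t < T z}"
proof -
  let ?U = "{z \<in> ball 0 1. ereal t < T z}"
  have "open ?U"
    unfolding backflow_image[OF t, symmetric]
    by (intro open_mapping_thm3 backflow_holomorphic inj_on_backflow order_refl t open_ball)
  then have "?U \<inter> closure {z \<in> ball 0 1. T z \<le> ereal t} = {}"
    by (subst open_Int_closure_eq_empty) auto
  moreover have "z \<in> ?U" if "z \<in> ball 0 1 - loewner_hull T t" for z
    using that closure_subset[of "{z \<in> ball 0 1. T z \<le> ereal t}"] by (force simp: loewner_hull_def)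
  ultimately show ?thesis by (auto simp: loewner_hull_def)
qed

lemma loewner_inverse_eq_backflow:
  assumes t: "0 \<le> t" and w: "norm w < 1"
  shows "loewner_inverse g T t w = backflow 0 t w"
  unfolding loewner_inverse_def flow_domain[OF t]
proof (rule inv_into_f_eq)
  show "inj_on (g t) {z \<in> ball 0 1. ereal t < T z}"
    using backflow_flow(2)[OF _ t] by (intro inj_on_inverseI[of _ "backflow 0 t"]) auto
qed (use flow_backflow[OF t w] norm_backflow_less[OF order_refl t w] in auto)

lemma loewner_psi_eq:
  "0 \<le> t \<Longrightarrow> norm w < 1 \<Longrightarrow> loewner_psi g T t w = backflow 0 t w / (1 - backflow 0 t w)"
  by (simp add: loewner_psi_def loewner_inverse_eq_backflow)

lemma transition_map_backflow:
  assumes s: "0 \<le> s" "s \<le> t"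
  shows "transition_map (loewner_psi g T s) (loewner_psi g T t) (backflow s t)"
  unfolding transition_map_def
  using s norm_backflow_less[OF s]
  by (auto simp: backflow_holomorphic inj_on_backflow loewner_psi_eq backflow_comp)

text \<open>Both \<open>z/(1 - z)\<close> and \<open>backflow 0 s\<close> are injective, so they can be cancelled on the left of
\<open>\<psi>\<^sub>s \<circ> h = \<psi>\<^sub>t = \<psi>\<^sub>s \<circ> backflow s t\<close>.\<close>
lemma transition_map_unique:
  assumes s: "0 \<le> s" "s \<le> t" and h: "transition_map (loewner_psi g T s) (loewner_psi g T t) h"
    and z: "norm z < 1"
  shows "h z = backflow s t z"
proof -
  have hz: "norm (h z) < 1" using h z by (auto simp: transition_map_def image_subset_iff)
  have bz: "norm (backflow s t z) < 1" by (rule norm_backflow_less[OF s z])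
  have t: "0 \<le> t" using s by simp
  let ?a = "backflow 0 s (h z)" and ?b = "backflow 0 t z"
  have "norm ?a < 1" "norm ?b < 1" using norm_backflow_less s t hz z by auto
  then have nz: "1 - ?a \<noteq> 0" "1 - ?b \<noteq> 0" by auto
  have "?a / (1 - ?a) = ?b / (1 - ?b)"
    using h z hz s t by (simp add: transition_map_def flip: loewner_psi_eq)
  then have "?a = ?b" using nz by (simp add: frac_eq_eq algebra_simps)
  then have "backflow 0 s (h z) = backflow 0 s (backflow s t z)"
    using s z by (simp add: backflow_comp)
  then show ?thesis
    using inj_onD[OF inj_on_backflow[OF order_refl s(1)]] hz bz by simp
qed

end

section \<open>The transition kernel\<close>

lemma represents_cong: "(\<And>z. z \<in> ball 0 1 \<Longrightarrow> F z = G z) \<Longrightarrow> represents \<kappa> F \<longleftrightarrow> represents \<kappa> G"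
  by (simp add: represents_def)

theorem theorem6:
  fixes \<mu> :: "real \<Rightarrow> complex measure"
    and g :: "real \<Rightarrow> complex \<Rightarrow> complex"
    and T :: "complex \<Rightarrow> ereal"
  assumes "\<forall>t\<ge>0. \<mu> t \<in> circle_measures"
    and "piecewise_weakly_continuous \<mu>"
    and "\<exists>C. \<forall>t\<ge>0. measure (\<mu> t) (sphere 0 1) \<le> C"
    and "\<forall>z\<in>ball 0 1. maximal_loewner_solution \<mu> z (T z) (\<lambda>t. g t z)"
  shows "(\<forall>t\<ge>0. \<exists>!\<nu>. represents \<nu> (loewner_psi g T t)) \<and>
    (\<forall>s t. 0 \<le> s \<and> s \<le> t \<longrightarrow>
       (\<exists>h. transition_map (loewner_psi g T s) (loewner_psi g T t) h)) \<and>
    (\<forall>H. (\<forall>s t. 0 \<le> s \<and> s \<le> t \<longrightarrow>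
            transition_map (loewner_psi g T s) (loewner_psi g T t) (H s t)) \<longrightarrow>
       (\<exists>k. markov_kernel k \<and>
          (\<forall>s t. 0 \<le> s \<and> s \<le> t \<longrightarrow> (\<forall>\<xi>\<in>sphere 0 1.
             represents (k s t \<xi>) (\<lambda>z. H s t z * \<xi> / (1 - H s t z * \<xi>)) \<and>
             (\<forall>\<kappa>. represents \<kappa> (\<lambda>z. H s t z * \<xi> / (1 - H s t z * \<xi>)) \<longrightarrow> \<kappa> = k s t \<xi>))) \<and>
          (\<forall>t\<ge>0. representing_measure (loewner_psi g T t) = k 0 t 1)))"
proof -
  obtain C where C: "\<forall>t\<ge>0. measure (\<mu> t) (sphere 0 1) \<le> C" using assms(3) by blast
  interpret loewner_flow \<mu> C g T
    using assms C by unfold_locales (auto simp: piecewise_weakly_continuous_def)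
  have psi: "\<exists>!\<nu>. represents \<nu> (loewner_psi g T t)" if t: "0 \<le> t" for t
  proof -
    have "\<exists>!\<nu>. represents \<nu> (\<lambda>z. backflow 0 t z * 1 / (1 - backflow 0 t z * 1))"
      using t by (intro self_map_represented backflow_holomorphic backflow_image_subset backflow_0) auto
    then show ?thesis
      using t by (subst represents_cong[of _ "\<lambda>z. backflow 0 t z * 1 / (1 - backflow 0 t z * 1)"])
        (auto simp: loewner_psi_eq)
  qed
  have kernel: "\<exists>k. markov_kernel k \<and>
          (\<forall>s t. 0 \<le> s \<and> s \<le> t \<longrightarrow> (\<forall>\<xi>\<in>sphere 0 1.
             represents (k s t \<xi>) (\<lambda>z. H s t z * \<xi> / (1 - H s t z * \<xi>)) \<and>
             (\<forall>\<kappa>. represents \<kappa> (\<lambda>z. H s t z * \<xi> / (1 - H s t z * \<xi>)) \<longrightarrow> \<kappa> = k s t \<xi>))) \<and>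
          (\<forall>t\<ge>0. representing_measure (loewner_psi g T t) = k 0 t 1)"
    if H: "\<forall>s t. 0 \<le> s \<and> s \<le> t \<longrightarrow> transition_map (loewner_psi g T s) (loewner_psi g T t) (H s t)" for H
  proof -
    define k where "k s t = self_map_kernel (H s t)" for s t
    have H_eq: "H s t z = backflow s t z" if "0 \<le> s" "s \<le> t" "norm z < 1" for s t z
      using transition_map_unique[of s t "H s t" z] H that by blast
    have hol: "H s t holomorphic_on ball 0 1" "H s t ` ball 0 1 \<subseteq> ball 0 1" "H s t 0 = 0"
      if "0 \<le> s" "s \<le> t" for s t
      using H that H_eq[OF that, of 0] backflow_0[OF that] by (auto simp: transition_map_def)
    have markov: "markov_kernel k"
      unfolding markov_kernel_def
    proof (intro conjI allI impI ballI)
      show "k s t \<in> circle \<rightarrow>\<^sub>M prob_algebra circle" if "0 \<le> s \<and> s \<le> t" for s t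
        unfolding k_def using that by (intro self_map_kernel_measurable hol) auto
      show "k t t \<xi> = return circle \<xi>" if "0 \<le> t" "\<xi> \<in> sphere 0 1" for t \<xi>
        unfolding k_def using that H_eq[of t t] backflow_curve(2)[of t] by (intro self_map_kernel_id) auto
      show "k s t \<xi> = k s r \<xi> \<bind> k r t" if "0 \<le> s \<and> s \<le> r \<and> r \<le> t" "\<xi> \<in> sphere 0 1" for s r t \<xi>
        unfolding k_def using that norm_backflow_less[of r t]
        by (intro self_map_kernel_comp hol) (auto simp: H_eq backflow_comp)
    qed
    have rep: "represents (k s t \<xi>) (\<lambda>z. H s t z * \<xi> / (1 - H s t z * \<xi>))"
      if "0 \<le> s" "s \<le> t" "\<xi> \<in> sphere 0 1" for s t \<xi>
      unfolding k_def using that by (intro represents_self_map_kernel hol) auto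
    have start: "representing_measure (loewner_psi g T t) = k 0 t 1" if t: "0 \<le> t" for t
    proof (rule representing_measure_eq)
      have "represents (k 0 t 1) (\<lambda>z. H 0 t z * 1 / (1 - H 0 t z * 1))"
        unfolding k_def using t by (intro represents_self_map_kernel hol) auto
      then show "represents (k 0 t 1) (loewner_psi g T t)"
        using t by (subst represents_cong[of _ "\<lambda>z. H 0 t z * 1 / (1 - H 0 t z * 1)"])
          (auto simp: loewner_psi_eq H_eq)
    qed
    show ?thesis
      by (intro exI[of _ k] conjI allI impI ballI markov start)
        (auto intro: rep represents_unique[OF _ rep])
  qed
  show ?thesis
    by (intro conjI allI impI psi kernel) (auto intro: transition_map_backflow)
qed

end
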